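(* If $\mathcal T$ is $\Lambda$-admissible and $E\in\mathcal T$, then the call $[\mathcal T_*]=$ CREATE_ADMISSIBLE_CHAIN$(\mathcal T,E,\Lambda)$ bisects once or twice the elements of the chain $\mathcal C(E)$, whose cardinality is at most $\ell(E)+1$, and produces a $\Lambda$-admissible mesh $\mathcal T_*$ with $E$ bisected once. Moreover, every element $E'\in\mathcal T_*$ generated by this call satisfies $$\ell(E')\le\ell(E)+1 .$$
   Context: **Meshes.** $\mathcal T_0$ is a conforming triangulation of the closure of a bounded polygonal domain in $\mathbb R^2$, each triangle having an assigned newest vertex, such that a side shared by two triangles of $\mathcal T_0$ is opposite to the newest vertex of both or of neither. Refinements $\mathcal T$ of $\mathcal T_0$ are obtained by finitely many newest-vertex bisections; hanging nodes are allowed. Nodes are the vertices of triangles of $\mathcal T$; a node is proper if it is a vertex of all triangles containing it, otherwise hanging. A hanging node $x$ was created as midpoint of a side $[x',x'']$ of a triangle of a preceding mesh. Global index: $\lambda(x)=0$ if $x$ is proper, $\lambda(x)=\max(\lambda(x'),\lambda(x''))+1$ if $x$ is hanging. For a fixed $\Lambda\ge1$, $\mathcal T$ is $\Lambda$-admissible if all its nodes have global index $\le\Lambda$. The level $\ell(E)$ is the number of successive bisections needed to generate $E$ from $\mathcal T_0$. **Chain.** For a triangle $E$, $nv(E)$ is its newest vertex, $oe(E)$ the opposite side, $moe(E)$ the midpoint of $oe(E)$; bisection joins $nv(E)$ with $moe(E)$, and $moe(E)$ is the newest vertex of both children. $\lambda(moe(E))$ is the global index that $moe(E)$ has, or would have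 once $E$ is bisected. Two elements $E',E''$ are adjacent if $e=E'\cap E''$ is a side of at least one of them; they are compatible if moreover neither $nv(E')$ nor $nv(E'')$ lies on the line containing $e$. If $\lambda(moe(E))>\Lambda$, the facing element of $E$ is the unique adjacent $\widetilde E\ne E$ in $\mathcal T$ with $E\cap\widetilde E=oe(E)$. $\mathcal C(E)=\{E_0,\dots,E_K\}$: $E_0=E$; given $E_k$: (i) if $\lambda(moe(E_k))\le\Lambda$, set $K=k$ and stop; (ii) if $\lambda(moe(E_k))=\Lambda+1$ and the facing element $\widetilde E_k$ is compatible with $E_k$, set $E_{k+1}=\widetilde E_k$, $K=k+1$ and stop; (iii) if $\lambda(moe(E_k))=\Lambda+1$ and $\widetilde E_k$ is not compatible with $E_k$, set $E_{k+1}=\widetilde E_k$ and continue. **CREATE_ADMISSIBLE_CHAIN**$(\mathcal T,E,\Lambda)$: for $k=K,K-1,\dots,1$: if $E_k$ and $E_{k-1}$ are compatible, bisect $E_k$ once; otherwise bisect $E_k$ and then bisect its child facing $E_{k-1}$. Finally bisect $E_0=E$ once. The result is $\mathcal T_*$. *)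

theory Defs
  imports "HOL-Analysis.Analysis"
begin

type_synonym point = "real ^ 2"

text \<open>The first component is the newest vertex, the other two are the endpoints of the opposite
  side. Their order is irrelevant: two elements of a mesh never have the same body.\<close>

datatype triangle = Triangle (nv: point) (base1: point) (base2: point)

type_synonym mesh = "triangle set"

definition vertices :: "triangle \<Rightarrow> point set" where
  "vertices E = {nv E, base1 E, base2 E}"

definition body :: "triangle \<Rightarrow> point set" where
  "body E = convex hull (vertices E)"

definition oe :: "triangle \<Rightarrow> point set" where
  "oe E = closed_segment (base1 E) (base2 E)"

definition moe :: "triangle \<Rightarrow> point" where
  "moe E = midpoint (base1 E) (base2 E)"

definition sides :: "triangle \<Rightarrow> point set set" where
  "sides E = {closed_segment (nv E) (base1 E), closed_segment (nv E) (base2 E), oe E}"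

definition polygonal_domain :: "point set \<Rightarrow> bool" where
  "polygonal_domain \<Omega> \<longleftrightarrow> open \<Omega> \<and> connected \<Omega> \<and> \<Omega> \<noteq> {} \<and>
     (\<exists>S. finite S \<and> frontier \<Omega> = (\<Union>(p, q)\<in>S. closed_segment p q))"

definition conforming_triangulation :: "point set \<Rightarrow> mesh \<Rightarrow> bool" where
  "conforming_triangulation X T \<longleftrightarrow>
     finite T \<and> (\<Union>E\<in>T. body E) = X \<and>
     (\<forall>E\<in>T. \<not> collinear (vertices E)) \<and>
     (\<forall>E\<in>T. \<forall>F\<in>T. E \<noteq> F \<longrightarrow>
        body E \<inter> body F = {} \<or>
        (\<exists>x \<in> vertices E \<inter> vertices F. body E \<inter> body F = {x}) \<or>
        body E \<inter> body F \<in> sides E \<inter> sides F)"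

definition initial_mesh :: "point set \<Rightarrow> mesh \<Rightarrow> bool" where
  "initial_mesh \<Omega> T0 \<longleftrightarrow>
     polygonal_domain \<Omega> \<and> bounded \<Omega> \<and>
     conforming_triangulation (closure \<Omega>) T0 \<and>
     (\<forall>E\<in>T0. \<forall>F\<in>T0. \<forall>s \<in> sides E \<inter> sides F. E \<noteq> F \<longrightarrow> (s = oe E \<longleftrightarrow> s = oe F))"

definition children :: "triangle \<Rightarrow> triangle set" where
  "children E = {Triangle (moe E) (nv E) (base1 E), Triangle (moe E) (base2 E) (nv E)}"

definition bisect :: "mesh \<Rightarrow> triangle \<Rightarrow> mesh" where
  "bisect T E = (T - {E}) \<union> children E"

inductive refinement :: "mesh \<Rightarrow> mesh \<Rightarrow> bool" for T where
  refl: "refinement T T"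
| step: "refinement T T' \<Longrightarrow> E \<in> T' \<Longrightarrow> refinement T (bisect T' E)"

inductive generated :: "mesh \<Rightarrow> nat \<Rightarrow> triangle \<Rightarrow> bool" for T0 where
  init: "E \<in> T0 \<Longrightarrow> generated T0 0 E"
| child: "generated T0 n E \<Longrightarrow> C \<in> children E \<Longrightarrow> generated T0 (Suc n) C"

definition level :: "mesh \<Rightarrow> triangle \<Rightarrow> nat" where
  "level T0 E = (LEAST n. generated T0 n E)"

definition nodes :: "mesh \<Rightarrow> point set" where
  "nodes T = (\<Union>E\<in>T. vertices E)"

definition proper_node :: "mesh \<Rightarrow> point \<Rightarrow> bool" where
  "proper_node T x \<longleftrightarrow> x \<in> nodes T \<and> (\<forall>E\<in>T. x \<in> body E \<longrightarrow> x \<in> vertices E)"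

definition hanging_node :: "mesh \<Rightarrow> point \<Rightarrow> bool" where
  "hanging_node T x \<longleftrightarrow> x \<in> nodes T \<and> \<not> proper_node T x"

text \<open>On the way from \<open>T0\<close> to \<open>T\<close>, the point \<open>x\<close> becomes a node by bisecting a triangle with
  side \<open>[x', x'']\<close> opposite to its newest vertex.\<close>

definition created_on :: "mesh \<Rightarrow> mesh \<Rightarrow> point \<Rightarrow> point \<Rightarrow> point \<Rightarrow> bool" where
  "created_on T0 T x x' x'' \<longleftrightarrow>
     (\<exists>T1 F. refinement T0 T1 \<and> F \<in> T1 \<and> refinement (bisect T1 F) T \<and>
             x \<notin> nodes T1 \<and> x = moe F \<and> x' = base1 F \<and> x'' = base2 F)"

inductive has_global_index :: "mesh \<Rightarrow> mesh \<Rightarrow> point \<Rightarrow> nat \<Rightarrow> bool" for T0 T where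
  proper: "proper_node T x \<Longrightarrow> has_global_index T0 T x 0"
| hanging: "hanging_node T x \<Longrightarrow> created_on T0 T x x' x'' \<Longrightarrow>
     has_global_index T0 T x' m \<Longrightarrow> has_global_index T0 T x'' n \<Longrightarrow>
     has_global_index T0 T x (max m n + 1)"

definition global_index :: "mesh \<Rightarrow> mesh \<Rightarrow> point \<Rightarrow> nat" where
  "global_index T0 T x = (THE n. has_global_index T0 T x n)"

definition admissible :: "mesh \<Rightarrow> nat \<Rightarrow> mesh \<Rightarrow> bool" where
  "admissible T0 \<Lambda> T \<longleftrightarrow> refinement T0 T \<and> (\<forall>x \<in> nodes T. global_index T0 T x \<le> \<Lambda>)"

text \<open>The global index that \<open>moe E\<close> has in \<open>T\<close> if it is a node already, and otherwise the one it
  would have once \<open>E\<close> is bisected.\<close>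

definition moe_index :: "mesh \<Rightarrow> mesh \<Rightarrow> triangle \<Rightarrow> nat" where
  "moe_index T0 T E =
     (if moe E \<in> nodes T then global_index T0 T (moe E)
      else global_index T0 (bisect T E) (moe E))"

definition adjacent :: "triangle \<Rightarrow> triangle \<Rightarrow> bool" where
  "adjacent E F \<longleftrightarrow> body E \<inter> body F \<in> sides E \<union> sides F"

definition compatible :: "triangle \<Rightarrow> triangle \<Rightarrow> bool" where
  "compatible E F \<longleftrightarrow> adjacent E F \<and>
     nv E \<notin> affine hull (body E \<inter> body F) \<and> nv F \<notin> affine hull (body E \<inter> body F)"

definition facing :: "mesh \<Rightarrow> triangle \<Rightarrow> triangle \<Rightarrow> bool" where
  "facing T E F \<longleftrightarrow> F \<in> T \<and> F \<noteq> E \<and> adjacent E F \<and> body E \<inter> body F = oe E"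

text \<open>\<open>adm_chain T0 \<Lambda> T E es\<close>: the construction of the chain of \<open>E\<close> in \<open>T\<close> stops, with
  \<open>es = [E\<^sub>0, \<dots>, E\<^sub>K]\<close>.\<close>

inductive adm_chain :: "mesh \<Rightarrow> nat \<Rightarrow> mesh \<Rightarrow> triangle \<Rightarrow> triangle list \<Rightarrow> bool"
  for T0 \<Lambda> T where
  stop: "moe_index T0 T E \<le> \<Lambda> \<Longrightarrow> adm_chain T0 \<Lambda> T E [E]"
| compat: "moe_index T0 T E = \<Lambda> + 1 \<Longrightarrow> facing T E F \<Longrightarrow> compatible E F \<Longrightarrow>
     adm_chain T0 \<Lambda> T E [E, F]"
| continue: "moe_index T0 T E = \<Lambda> + 1 \<Longrightarrow> facing T E F \<Longrightarrow> \<not> compatible E F \<Longrightarrow>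
     adm_chain T0 \<Lambda> T F es \<Longrightarrow> adm_chain T0 \<Lambda> T E (E # es)"

text \<open>\<open>chain_loop T [E\<^sub>0, \<dots>, E\<^sub>K] T'\<close>: the loop over \<open>k = K, \<dots>, 1\<close> transforms \<open>T\<close> into \<open>T'\<close>.
  The iteration \<open>k = 1\<close>, which bisects \<open>F = E\<^sub>1\<close>, comes last. An element can only be bisected
  while it belongs to the current mesh.\<close>

inductive chain_loop :: "mesh \<Rightarrow> triangle list \<Rightarrow> mesh \<Rightarrow> bool" for T where
  single: "chain_loop T [E] T"
| once: "chain_loop T (F # es) T1 \<Longrightarrow> compatible F E \<Longrightarrow> F \<in> T1 \<Longrightarrow>
     chain_loop T (E # F # es) (bisect T1 F)"
| twice: "chain_loop T (F # es) T1 \<Longrightarrow> \<not> compatible F E \<Longrightarrow> F \<in> T1 \<Longrightarrow>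
     C \<in> children F \<Longrightarrow> facing (bisect T1 F) E C \<Longrightarrow>
     chain_loop T (E # F # es) (bisect (bisect T1 F) C)"

definition create_admissible_chain ::
    "mesh \<Rightarrow> mesh \<Rightarrow> triangle \<Rightarrow> nat \<Rightarrow> mesh \<Rightarrow> bool" where
  "create_admissible_chain T0 T E \<Lambda> Tstar \<longleftrightarrow>
     (\<exists>es T'. adm_chain T0 \<Lambda> T E es \<and> chain_loop T es T' \<and> E \<in> T' \<and> Tstar = bisect T' E)"

text \<open>The elements of \<open>T\<close> obtained from \<open>F\<close> by zero or more successive bisections.\<close>

definition progeny :: "mesh \<Rightarrow> triangle \<Rightarrow> mesh" where
  "progeny T F = {G \<in> T. \<exists>n. generated {F} n G}"

definition bisected_once :: "mesh \<Rightarrow> triangle \<Rightarrow> bool" where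
  "bisected_once T F \<longleftrightarrow> progeny T F = children F"

definition bisected_twice :: "mesh \<Rightarrow> triangle \<Rightarrow> bool" where
  "bisected_twice T F \<longleftrightarrow> (\<exists>C \<in> children F. progeny T F = bisect (children F) C)"

end

theory Submission
  imports Defs
begin

text \<open>
  The proof compares every mesh with the uniform refinements of \<open>T0\<close>: the mesh of level \<open>n\<close> consists
  of all triangles that arise from \<open>T0\<close> by \<open>n\<close> successive bisections.  Bisecting all triangles of a
  conforming mesh with matching newest vertices gives such a mesh again, because neighbours that share
  a bisected side share its midpoint (\<open>conforming_refine_all\<close>, \<open>matching_refine_all\<close>).  So all uniform
  refinements are conforming.  Two things follow.  A node of level \<open>n\<close> is a vertex of every triangle
  of level at least \<open>n\<close> that contains it (\<open>N_vertex\<close>), and a point that is not a node of level \<open>n\<close>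
  lies in at most two triangles of level \<open>n\<close> (\<open>three_elements_N\<close>), since a side belongs to at most two
  of them.  The elements of an arbitrary refinement of \<open>T0\<close> have pairwise disjoint progenies
  (\<open>mesh_disjoint\<close>), so questions about elements of different levels are settled by passing to
  descendants or ancestors on one common level.

  In this way the pair of points between which a node is created depends on the node alone
  (\<open>parents_moe\<close>), the global index is well defined, a bisection never increases it
  (\<open>global_index_bisect_le\<close>), and a hanging node hangs on exactly one element
  (\<open>hanging_element_unique\<close>).  The facing element \<open>F\<close> of \<open>E\<close> exists whenever the chain needs it; its level
  is at most that of \<open>E\<close>, and smaller if \<open>F\<close> is not compatible with \<open>E\<close> (\<open>facing_level\<close>).  Hence the levels
  decrease strictly along the chain, except perhaps in its last step.  This bounds both the length of
  the chain and the levels of the new elements; the exceptional last step costs nothing, because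
  index \<open>\<Lambda> + 1 \<ge> 2\<close> cannot occur on level \<open>0\<close> (\<open>moe_index_level_0\<close>).

  Admissibility rests on one observation (\<open>admissible_bisect_compatible_pair\<close>): if \<open>oe E\<close> lies in
  \<open>oe F\<close>, then \<open>F\<close> and after it \<open>E\<close> may be bisected.  If the two segments coincide, the only new
  node becomes proper.  Otherwise the midpoint of \<open>oe F\<close> is already a node, hanging on \<open>F\<close> only, and
  bisecting \<open>F\<close> makes it proper.  As every other node in the interior of \<open>oe F\<close> descends from this
  midpoint, all their indices drop by at least one (\<open>index_drops_on_bisected_edge\<close>), which leaves room
  for the midpoint of \<open>oe E\<close>.  In a step to an incompatible facing element, one of its two children
  plays the role of \<open>F\<close>.
\<close>

section \<open>Triangles and their faces\<close>

text \<open>Twice the signed area of the triangle \<open>a b c\<close>.\<close>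

definition orient :: "point \<Rightarrow> point \<Rightarrow> point \<Rightarrow> real" where
  "orient a b c = (b$1 - a$1) * (c$2 - a$2) - (b$2 - a$2) * (c$1 - a$1)"

lemma collinear_iff_orient: "collinear {a, b, c} \<longleftrightarrow> orient a b c = 0"
proof
  assume "collinear {a, b, c}"
  then consider "a = c" | u where "b = u *\<^sub>R a + (1 - u) *\<^sub>R c"
    by (auto simp: collinear_3_expand)
  then show "orient a b c = 0"
  proof cases
    case (2 u)
    then have "b$1 = u * a$1 + (1 - u) * c$1" "b$2 = u * a$2 + (1 - u) * c$2" by simp_all
    then show ?thesis unfolding orient_def by algebra
  qed (simp add: orient_def)
next
  assume 0: "orient a b c = 0"
  show "collinear {a, b, c}"
  proof (cases "a = c")
    case False
    define w where "w = a - c"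
    define v where "v = b - c"
    have w: "w$1 \<noteq> 0 \<or> w$2 \<noteq> 0" using False by (auto simp: w_def vec_eq_iff forall_2)
    have vw: "v$1 * w$2 = v$2 * w$1" using 0 by (simp add: v_def w_def orient_def algebra_simps)
    obtain u where u: "v = u *\<^sub>R w"
    proof (cases "w$1 = 0")
      case True
      then have "v = (v$2 / w$2) *\<^sub>R w" using w vw by (simp add: vec_eq_iff forall_2)
      then show thesis by (rule that)
    next
      case False
      then have "v = (v$1 / w$1) *\<^sub>R w" using vw by (simp add: vec_eq_iff forall_2 field_simps)
      then show thesis by (rule that)
    qed
    have "b = u *\<^sub>R a + (1 - u) *\<^sub>R c"
      using u unfolding v_def w_def by (simp add: algebra_simps diff_eq_eq)
    then show ?thesis by (auto simp: collinear_3_expand)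
  qed (simp add: insert_commute)
qed

definition nondegenerate :: "triangle \<Rightarrow> bool" where
  "nondegenerate E \<longleftrightarrow> \<not> collinear (vertices E)"

text \<open>Twice the area. Bisection halves it, so it shows that an element is not its own proper descendant.\<close>

definition area2 :: "triangle \<Rightarrow> real" where
  "area2 E = \<bar>orient (nv E) (base1 E) (base2 E)\<bar>"

definition base :: "triangle \<Rightarrow> point set" where
  "base E = {base1 E, base2 E}"

lemma vertices_eq: "vertices E = insert (nv E) (base E)"
  by (simp add: vertices_def base_def)

lemma oe_eq_hull: "oe E = convex hull base E"
  by (simp add: oe_def base_def segment_convex_hull)

lemma convex_body [simp]: "convex (body E)"
  by (simp add: body_def)

lemma vertices_subset_body: "vertices E \<subseteq> body E"
  by (simp add: body_def hull_subset)

lemma nondegenerate_iff_area: "nondegenerate E \<longleftrightarrow> area2 E > 0"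
  by (simp add: nondegenerate_def vertices_def collinear_iff_orient area2_def)

lemma nondegenerate_independent: "nondegenerate E \<Longrightarrow> \<not> affine_dependent (vertices E)"
  by (simp add: nondegenerate_def vertices_def collinear_3_eq_affine_dependent)

lemma nondegenerate_distinct:
  assumes "nondegenerate E"
  shows "nv E \<noteq> base1 E" "nv E \<noteq> base2 E" "base1 E \<noteq> base2 E"
  using assms by (auto simp: nondegenerate_def vertices_def collinear_3_eq_affine_dependent)

text \<open>The theory of faces replaces computations with barycentric coordinates: the hull of any set of
  vertices is a face of the triangle, and a face absorbs the endpoints of a segment whose midpoint it
  contains.\<close>

lemma hull_face_of_body:
  assumes "nondegenerate E" "S \<subseteq> vertices E"
  shows "(convex hull S) face_of body E"
  using assms face_of_convex_hull_affine_independent[OF nondegenerate_independent]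
  unfolding body_def by blast

lemma vertex_in_hull:
  assumes "nondegenerate E" "S \<subseteq> vertices E" "x \<in> vertices E" "x \<in> convex hull S"
  shows "x \<in> S"
proof -
  have "x extreme_point_of (convex hull vertices E)"
    using assms nondegenerate_independent extreme_point_of_convex_hull_affine_independent by blast
  then have "x extreme_point_of (convex hull S)"
    using assms(2,4) by (meson extreme_point_of_def hull_mono subsetD)
  then show ?thesis using extreme_point_of_convex_hull by blast
qed

lemma hull_Int_hull:
  assumes "nondegenerate E" "A \<subseteq> vertices E" "B \<subseteq> vertices E"
  shows "convex hull A \<inter> convex hull B = convex hull (A \<inter> B)"
proof
  have "(convex hull A \<inter> convex hull B) face_of (convex hull vertices E)"
    using assms hull_face_of_body by (auto simp: body_def intro: face_of_Int)
  then obtain S where S: "S \<subseteq> vertices E" "convex hull A \<inter> convex hull B = convex hull S"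
    using face_of_convex_hull_affine_independent[OF nondegenerate_independent[OF assms(1)]] by blast
  have "S \<subseteq> A \<inter> B"
  proof
    fix x assume x: "x \<in> S"
    then have "x \<in> convex hull A \<inter> convex hull B" unfolding S(2) by (rule hull_inc)
    then show "x \<in> A \<inter> B" using vertex_in_hull assms S(1) x by blast
  qed
  then show "convex hull A \<inter> convex hull B \<subseteq> convex hull (A \<inter> B)"
    unfolding S(2) by (rule hull_mono)
qed (simp add: hull_mono)

lemma body_Int_affine_hull:
  assumes "nondegenerate E" "S \<subseteq> vertices E"
  shows "body E \<inter> affine hull S = convex hull S"
  using face_of_imp_eq_affine_Int[OF convex_body hull_face_of_body[OF assms]]
  by (simp add: affine_hull_convex_hull Int_commute)

lemma midpoint_in_face:
  assumes "nondegenerate E" "S \<subseteq> vertices E" "p \<in> body E" "q \<in> body E"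
    and "midpoint p q \<in> convex hull S"
  shows "p \<in> convex hull S" "q \<in> convex hull S"
proof -
  have "p \<in> convex hull S \<and> q \<in> convex hull S"
  proof (cases "p = q")
    case False
    then show ?thesis
      using face_ofD[OF hull_face_of_body[OF assms(1,2)], of "midpoint p q" p q] assms by simp
  qed (use assms in auto)
  then show "p \<in> convex hull S" "q \<in> convex hull S" by auto
qed

lemma base_subset_body: "base E \<subseteq> body E" "base E \<subseteq> vertices E"
  using vertices_subset_body by (auto simp: vertices_eq)

lemma moe_in_hull_imp_base:
  assumes "nondegenerate E" "S \<subseteq> vertices E" "moe E \<in> convex hull S"
  shows "base E \<subseteq> S"
proof -
  have "base1 E \<in> convex hull S" "base2 E \<in> convex hull S"
    using midpoint_in_face[OF assms(1,2), of "base1 E" "base2 E"] assms(3) base_subset_body(1)[of E]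
    by (simp_all add: moe_def base_def)
  then show ?thesis using vertex_in_hull[OF assms(1,2)] base_subset_body by (auto simp: base_def)
qed

lemma moe_in_oe: "moe E \<in> oe E"
  by (simp add: moe_def oe_def)

lemma oe_subset_body: "oe E \<subseteq> body E"
  unfolding oe_eq_hull body_def by (simp add: hull_mono base_subset_body)

lemma moe_not_vertex: 
  assumes "nondegenerate E"
  shows "moe E \<notin> vertices E"
proof
  assume "moe E \<in> vertices E"
  then have "base E \<subseteq> {moe E}" using moe_in_hull_imp_base[OF assms, of "{moe E}"] by simp
  then show False using nondegenerate_distinct[OF assms] by (auto simp: base_def)
qed

lemma nv_notin_affine_oe:
  assumes "nondegenerate E"
  shows "nv E \<notin> affine hull (oe E)"
proof
  assume "nv E \<in> affine hull (oe E)"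
  then have "nv E \<in> convex hull base E"
    using body_Int_affine_hull[OF assms base_subset_body(2)] vertices_subset_body
    by (auto simp: oe_eq_hull affine_hull_convex_hull vertices_eq)
  then have "nv E \<in> base E"
    using vertex_in_hull[OF assms base_subset_body(2)] by (metis insertI1 vertices_eq)
  then show False using nondegenerate_distinct[OF assms] by (auto simp: base_def)
qed

lemma body_collinear_with_base:
  assumes "nondegenerate E" "y \<in> body E" "collinear {base1 E, base2 E, y}"
  shows "y \<in> oe E"
proof -
  have "y \<in> affine hull base E"
    using assms nondegenerate_distinct collinear_3_affine_hull unfolding base_def by blast
  then show ?thesis
    using body_Int_affine_hull[OF assms(1) base_subset_body(2)] assms(2) by (auto simp: oe_eq_hull)
qed

section \<open>Bisection of one triangle\<close>

lemma children_cases: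
  assumes "C \<in> children E"
  obtains "C = Triangle (moe E) (nv E) (base1 E)" | "C = Triangle (moe E) (base2 E) (nv E)"
  using assms by (auto simp: children_def)

lemma area2_child:
  assumes "C \<in> children E"
  shows "area2 C = area2 E / 2"
  using assms
proof (cases rule: children_cases)
  case 1
  have "orient (moe E) (nv E) (base1 E) = orient (nv E) (base1 E) (base2 E) / 2"
    by (simp add: orient_def moe_def midpoint_def field_simps)
  then show ?thesis by (simp add: 1 area2_def)
next
  case 2
  have "orient (moe E) (base2 E) (nv E) = orient (nv E) (base1 E) (base2 E) / 2"
    by (simp add: orient_def moe_def midpoint_def field_simps)
  then show ?thesis by (simp add: 2 area2_def)
qed

lemma nondegenerate_child: "nondegenerate E \<Longrightarrow> C \<in> children E \<Longrightarrow> nondegenerate C"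
  by (simp add: nondegenerate_iff_area area2_child)

lemma vertices_child:
  assumes "C \<in> children E"
  shows "vertices C \<subseteq> insert (moe E) (vertices E)"
  using assms by (auto simp: children_def vertices_def)

lemma nv_child: "C \<in> children E \<Longrightarrow> nv C = moe E"
  by (auto simp: children_def)

lemma base_child: 
  assumes "C \<in> children E"
  obtains b where "b \<in> base E" "base C = {nv E, b}"
  using assms by (cases rule: children_cases) (auto simp: base_def insert_commute)

lemma child_with_base:
  assumes "b \<in> base E"
  obtains C where "C \<in> children E" "base C = {nv E, b}"
  using assms by (force simp: children_def base_def)

lemma vertices_children: "(\<Union>C\<in>children E. vertices C) = insert (moe E) (vertices E)"
  by (auto simp: children_def vertices_def)

lemma body_child:
  assumes "C \<in> children E"
  shows "body C \<subseteq> body E"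
proof -
  have "vertices C \<subseteq> body E"
    using vertices_child[OF assms] vertices_subset_body moe_in_oe oe_subset_body by blast
  then show ?thesis unfolding body_def[of C] by (simp add: hull_minimal)
qed

lemma children_cover:
  assumes "x \<in> body E"
  obtains C where "C \<in> children E" "x \<in> body C"
proof -
  obtain a b c where abc: "0 \<le> a" "0 \<le> b" "0 \<le> c" "a + b + c = 1"
    and x: "x = a *\<^sub>R nv E + b *\<^sub>R base1 E + c *\<^sub>R base2 E"
    using assms unfolding body_def vertices_def convex_hull_3 by blast
  have m: "moe E = (1/2) *\<^sub>R base1 E + (1/2) *\<^sub>R base2 E"
    by (simp add: moe_def midpoint_def algebra_simps)
  show thesis
  proof (cases "c \<le> b")
    case True
    have "x = (2*c) *\<^sub>R moe E + a *\<^sub>R nv E + (b - c) *\<^sub>R base1 E"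
      by (simp add: x m algebra_simps)
    then have "x \<in> body (Triangle (moe E) (nv E) (base1 E))"
      unfolding body_def vertices_def convex_hull_3 using abc True
      by (simp, intro exI[of _ "2*c"] exI[of _ a] exI[of _ "b - c"]) simp
    then show thesis using that by (auto simp: children_def)
  next
    case False
    have "x = (2*b) *\<^sub>R moe E + (c - b) *\<^sub>R base2 E + a *\<^sub>R nv E"
      by (simp add: x m algebra_simps)
    then have "x \<in> body (Triangle (moe E) (base2 E) (nv E))"
      unfolding body_def vertices_def convex_hull_3 using abc False
      by (simp, intro exI[of _ "2*b"] exI[of _ "c - b"] exI[of _ a]) simp
    then show thesis using that by (auto simp: children_def)
  qed
qed

text \<open>The line through \<open>moe E\<close> and \<open>nv E\<close> separates the two remaining vertices \<open>base1 E\<close> and \<open>base2 E\<close>,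
  because \<open>moe E\<close> is the midpoint between them.\<close>

lemma siblings_Int:
  assumes nd: "nondegenerate E" and C: "C \<in> children E" and D: "D \<in> children E" and ne: "C \<noteq> D"
  shows "vertices C \<inter> vertices D = {moe E, nv E}" "body C \<inter> body D = convex hull {moe E, nv E}"
proof -
  define C1 where "C1 = Triangle (moe E) (nv E) (base1 E)"
  define C2 where "C2 = Triangle (moe E) (base2 E) (nv E)"
  have mv: "moe E \<notin> vertices E" using moe_not_vertex[OF nd] .
  have V: "vertices C1 \<inter> vertices C2 = {moe E, nv E}"
    using mv nondegenerate_distinct[OF nd] by (auto simp: C1_def C2_def vertices_def)
  have "body C1 \<inter> body C2 \<subseteq> convex hull {moe E, nv E}"
  proof
    fix x assume x: "x \<in> body C1 \<inter> body C2"
    let ?f = "orient (moe E) (nv E)"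
    have aff: "?f (u *\<^sub>R moe E + v *\<^sub>R nv E + w *\<^sub>R b) = w * ?f b" if "u + v + w = 1" for u v w b
    proof -
      have "u = 1 - v - w" using that by simp
      then show ?thesis unfolding orient_def vector_add_component vector_scaleR_component real_scaleR_def
        by algebra
    qed
    obtain u v w where 1: "0 \<le> u" "0 \<le> v" "0 \<le> w" "u + v + w = 1"
      "x = u *\<^sub>R moe E + v *\<^sub>R nv E + w *\<^sub>R base1 E"
      using x unfolding C1_def body_def vertices_def convex_hull_3 by auto
    obtain u' v' w' where 2: "0 \<le> u'" "0 \<le> v'" "0 \<le> w'" "u' + w' + v' = 1"
      "x = u' *\<^sub>R moe E + w' *\<^sub>R base2 E + v' *\<^sub>R nv E"
      using x unfolding C2_def body_def vertices_def convex_hull_3 by force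
    have f: "?f (base2 E) = - ?f (base1 E)"
      by (simp add: orient_def moe_def midpoint_def field_simps)
    have fx: "?f x = w * ?f (base1 E)" unfolding 1(5) by (rule aff[OF 1(4)])
    have fx': "?f x = w' * ?f (base2 E)"
    proof -
      have "x = u' *\<^sub>R moe E + v' *\<^sub>R nv E + w' *\<^sub>R base2 E" unfolding 2(5) by simp
      moreover have "u' + v' + w' = 1" using 2(4) by simp
      ultimately show ?thesis using aff by metis
    qed
    have "?f (base1 E) \<noteq> 0"
    proof -
      have "nondegenerate C1" using nondegenerate_child[OF nd] by (simp add: C1_def children_def)
      then show ?thesis by (simp add: nondegenerate_def C1_def vertices_def collinear_iff_orient)
    qed
    moreover have "(w + w') * ?f (base1 E) = 0"
    proof -
      have "w * ?f (base1 E) = - (w' * ?f (base1 E))"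
        using fx' unfolding fx f by (rule trans) (rule mult_minus_right)
      then show ?thesis by (simp add: distrib_right)
    qed
    ultimately have "w + w' = 0" unfolding mult_eq_0_iff by blast
    then have "w = 0" using 1(3) 2(3) by (simp add: add_nonneg_eq_0_iff)
    then show "x \<in> convex hull {moe E, nv E}"
      unfolding convex_hull_2 using 1 by (intro CollectI exI[of _ u] exI[of _ v]) simp
  qed
  moreover have "convex hull {moe E, nv E} \<subseteq> body C1 \<inter> body C2"
    unfolding body_def V[symmetric] by (simp add: hull_mono)
  ultimately have B: "body C1 \<inter> body C2 = convex hull {moe E, nv E}" by (rule subset_antisym)
  consider "C = C1" "D = C2" | "C = C2" "D = C1"
    using C D ne by (auto simp: children_def C1_def C2_def)
  then have "vertices C \<inter> vertices D = {moe E, nv E} \<and> body C \<inter> body D = convex hull {moe E, nv E}"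
    using V B by cases (simp_all add: Int_commute)
  then show "vertices C \<inter> vertices D = {moe E, nv E}" "body C \<inter> body D = convex hull {moe E, nv E}"
    by simp_all
qed

text \<open>Cutting a triangle with a face of a larger one gives a face of the smaller one, and the faces of
  a triangle are the hulls of its sets of vertices. This locates the intersection of children of
  different elements.\<close>

lemma subtriangle_Int_face:
  assumes "nondegenerate E" "nondegenerate C" "body C \<subseteq> body E" "S \<subseteq> vertices E"
  shows "body C \<inter> convex hull S = convex hull (vertices C \<inter> convex hull S)"
proof
  have "(convex hull S \<inter> body C) face_of (body E \<inter> body C)"
    by (rule face_of_slice[OF hull_face_of_body[OF assms(1,4)]]) simp
  then have "(convex hull S \<inter> body C) face_of (convex hull vertices C)"
    using assms(3) by (simp add: Int_absorb1 body_def)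
  then obtain A where A: "A \<subseteq> vertices C" "convex hull S \<inter> body C = convex hull A"
    using face_of_convex_hull_affine_independent[OF nondegenerate_independent[OF assms(2)]] by blast
  have "A \<subseteq> convex hull S \<inter> body C" unfolding A(2) by (rule hull_subset)
  then have "A \<subseteq> vertices C \<inter> convex hull S" using A(1) by simp
  then have "convex hull A \<subseteq> convex hull (vertices C \<inter> convex hull S)" by (rule hull_mono)
  then show "body C \<inter> convex hull S \<subseteq> convex hull (vertices C \<inter> convex hull S)"
    unfolding A(2)[symmetric] by (simp add: Int_commute)
next
  have "convex hull (vertices C \<inter> convex hull S) \<subseteq> convex hull S"
    by (simp add: hull_minimal)
  then show "convex hull (vertices C \<inter> convex hull S) \<subseteq> body C \<inter> convex hull S"
    unfolding body_def by (simp add: hull_mono)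
qed

section \<open>Conforming meshes\<close>

text \<open>The usual alternatives (disjoint, one common vertex, one common side) in a single equation. It allows
  the common vertices to be all three; collinearity excludes this, that is, it excludes two
  elements with the same body.\<close>

definition conforming :: "mesh \<Rightarrow> bool" where
  "conforming U \<longleftrightarrow> (\<forall>E\<in>U. nondegenerate E) \<and>
     (\<forall>E\<in>U. \<forall>F\<in>U. E \<noteq> F \<longrightarrow>
        body E \<inter> body F = convex hull (vertices E \<inter> vertices F) \<and> collinear (body E \<inter> body F))"

text \<open>In a conforming mesh, \<open>base E \<subseteq> vertices F\<close> says that \<open>oe E\<close> is a side of \<open>F\<close>; it then has to be
  the side opposite to the newest vertex of \<open>F\<close>.\<close>

definition matching :: "mesh \<Rightarrow> bool" where
  "matching U \<longleftrightarrow> (\<forall>E\<in>U. \<forall>F\<in>U. E \<noteq> F \<longrightarrow> base E \<subseteq> vertices F \<longrightarrow> base E = base F)"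

lemma conformingD:
  assumes "conforming U" "E \<in> U" "F \<in> U" "E \<noteq> F"
  shows "body E \<inter> body F = convex hull (vertices E \<inter> vertices F)" "collinear (body E \<inter> body F)"
  using assms(1)[unfolded conforming_def, THEN conjunct2, rule_format, OF assms(2-4)] by blast+

lemma matchingD:
  assumes "matching U" "E \<in> U" "F \<in> U" "E \<noteq> F" "base E \<subseteq> vertices F"
  shows "base E = base F"
  using assms(1)[unfolded matching_def, rule_format, OF assms(2-5)] .

lemma conforming_nondegenerate: "conforming U \<Longrightarrow> E \<in> U \<Longrightarrow> nondegenerate E"
  by (simp add: conforming_def)

definition refine_all :: "mesh \<Rightarrow> mesh" where
  "refine_all U = (\<Union>E\<in>U. children E)"

lemma half_segments_Int:
  fixes p q :: point
  assumes "p \<noteq> q" "A \<in> {{midpoint p q, p}, {midpoint p q, q}}" "B \<in> {{midpoint p q, p}, {midpoint p q, q}}"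
  shows "convex hull A \<inter> convex hull B = convex hull (A \<inter> B)"
proof -
  let ?m = "midpoint p q"
  have "closed_segment p ?m \<inter> closed_segment ?m q = {?m}"
    by (rule Int_closed_segment) simp
  then have "convex hull {?m, p} \<inter> convex hull {?m, q} = {?m}"
    by (simp add: segment_convex_hull insert_commute)
  moreover have "{?m, p} \<inter> {?m, q} = {?m}" using assms(1) by auto
  ultimately have "convex hull {?m, p} \<inter> convex hull {?m, q} = convex hull ({?m, p} \<inter> {?m, q})"
    by (simp only: convex_hull_singleton)
  then have "convex hull A \<inter> convex hull B = convex hull (A \<inter> B)"
    if "A = {?m, p}" "B = {?m, q}" for A B
    using that by simp
  then show ?thesis using assms(2,3) by (metis Int_absorb Int_commute empty_iff insert_iff)
qed

text \<open>The intersection lies in the common face \<open>convex hull S\<close> of the parents, so only the points of the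
  children in that face matter. If the face is the bisected side of one parent, matching makes it
  the bisected side of both, and both children have one of its halves; otherwise neither bisection
  adds a vertex to it.\<close>

lemma children_Int_neighbours:
  assumes U: "conforming U" "matching U" and EF: "E \<in> U" "F \<in> U" "E \<noteq> F"
    and C: "C \<in> children E" and D: "D \<in> children F"
  shows "body C \<inter> body D = convex hull (vertices C \<inter> vertices D)"
proof -
  define S where "S = vertices E \<inter> vertices F"
  note S = conformingD[OF U(1) EF, folded S_def]
  have nd: "nondegenerate E" "nondegenerate F" using U(1) EF conforming_nondegenerate by auto
  have ndC: "nondegenerate C" "nondegenerate D" using nondegenerate_child nd C D by auto
  have SE: "S \<subseteq> vertices E" "S \<subseteq> vertices F" by (auto simp: S_def)
  define A where "A = vertices C \<inter> convex hull S"
  define B where "B = vertices D \<inter> convex hull S"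
  have "body C \<inter> body D \<subseteq> convex hull S" using body_child C D S by blast
  then have "body C \<inter> body D = (body C \<inter> convex hull S) \<inter> (body D \<inter> convex hull S)" by blast
  also have "\<dots> = convex hull A \<inter> convex hull B"
    unfolding A_def B_def
    using subtriangle_Int_face nd ndC SE body_child C D by simp
  also have "\<dots> = convex hull (A \<inter> B)"
  proof (cases "base E \<subseteq> S \<or> base F \<subseteq> S")
    case True
    then have bEF: "base E = base F" "base E \<subseteq> S"
      using matchingD[OF U(2) EF] matchingD[OF U(2) EF(2,1)] EF(3) SE by auto
    have SB: "S \<subseteq> body E \<inter> body F" using vertices_subset_body unfolding S_def by blast
    have "nv E \<notin> S"
    proof
      assume "nv E \<in> S"
      then have "vertices E \<subseteq> body E \<inter> body F" using bEF(2) SB unfolding vertices_eq by blast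
      then show False using S(2) nd collinear_subset nondegenerate_def by blast
    qed
    moreover have "nv F \<notin> S"
    proof
      assume "nv F \<in> S"
      then have "vertices F \<subseteq> body E \<inter> body F" using bEF SB unfolding vertices_eq by blast
      then show False using S(2) nd collinear_subset nondegenerate_def by blast
    qed
    ultimately have nS: "nv E \<notin> convex hull S" "nv F \<notin> convex hull S"
      using vertex_in_hull nd SE by (auto simp: vertices_eq)
    have mEF: "moe E = moe F"
      using bEF(1) by (auto simp: moe_def base_def doubleton_eq_iff midpoint_sym)
    have m: "moe E \<in> convex hull S"
      using moe_in_oe[of E] hull_mono[OF bEF(2), of convex] by (auto simp: oe_eq_hull)
    have "base E \<subseteq> convex hull S" "base F \<subseteq> convex hull S"
      using bEF hull_subset[of S convex] by auto
    then have b: "base1 E \<in> convex hull S" "base2 E \<in> convex hull S"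
        "base1 F \<in> convex hull S" "base2 F \<in> convex hull S"
      by (simp_all add: base_def)
    have "A = {moe E, base1 E} \<or> A = {moe E, base2 E}"
      using C nS(1) m b unfolding A_def by (auto simp: children_def vertices_def)
    moreover have "B = {moe E, base1 F} \<or> B = {moe E, base2 F}"
      using D nS(2) m b unfolding B_def mEF by (auto simp: children_def vertices_def)
    moreover have "base1 F \<in> {base1 E, base2 E}" "base2 F \<in> {base1 E, base2 E}"
      using bEF(1) unfolding base_def by blast+
    ultimately have "A \<in> {{moe E, base1 E}, {moe E, base2 E}}" "B \<in> {{moe E, base1 E}, {moe E, base2 E}}"
      by fastforce+
    then show ?thesis
      unfolding moe_def by (rule half_segments_Int[OF nondegenerate_distinct(3)[OF nd(1)]])
  next
    case False
    then have "moe E \<notin> convex hull S" "moe F \<notin> convex hull S"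
      using moe_in_hull_imp_base nd SE by blast+
    then have "A \<subseteq> vertices E \<inter> convex hull S" "B \<subseteq> vertices F \<inter> convex hull S"
      using vertices_child C D unfolding A_def B_def by blast+
    then have "A \<subseteq> S" "B \<subseteq> S" using vertex_in_hull nd SE by blast+
    then have "A \<subseteq> vertices E" "B \<subseteq> vertices E" using SE(1) by blast+
    then show ?thesis by (rule hull_Int_hull[OF nd(1)])
  qed
  also have "A \<inter> B = vertices C \<inter> vertices D"
    using \<open>body C \<inter> body D \<subseteq> convex hull S\<close> vertices_subset_body unfolding A_def B_def by blast
  finally show ?thesis .
qed

lemma conforming_refine_all:
  assumes U: "conforming U" "matching U"
  shows "conforming (refine_all U)"
  unfolding conforming_def
proof (intro conjI ballI impI)
  fix C assume "C \<in> refine_all U"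
  then show "nondegenerate C"
    using U nondegenerate_child conforming_nondegenerate by (auto simp: refine_all_def)
next
  fix C D assume "C \<in> refine_all U" "D \<in> refine_all U" and ne: "C \<noteq> D"
  then obtain E F where *: "E \<in> U" "F \<in> U" "C \<in> children E" "D \<in> children F"
    by (auto simp: refine_all_def)
  have nd: "nondegenerate E" using * U conforming_nondegenerate by auto
  show "body C \<inter> body D = convex hull (vertices C \<inter> vertices D)"
    using siblings_Int[OF nd] children_Int_neighbours[OF U] * ne by (cases "E = F") auto
  show "collinear (body C \<inter> body D)"
  proof (cases "E = F")
    case True
    then show ?thesis using siblings_Int(2)[OF nd] * ne by (simp flip: segment_convex_hull)
  next
    case False
    then show ?thesis using conformingD(2)[OF U(1)] * body_child
      by (meson Int_mono collinear_subset)
  qed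
qed

lemma conforming_vertices_proper:
  assumes "conforming U" "x \<in> nodes U" "E \<in> U" "x \<in> body E"
  shows "x \<in> vertices E"
proof -
  obtain F where F: "F \<in> U" "x \<in> vertices F" using assms by (auto simp: nodes_def)
  show ?thesis
  proof (cases "E = F")
    case False
    then have "x \<in> convex hull (vertices E \<inter> vertices F)"
      using conformingD[OF assms(1,3) F(1)] assms(4) F(2) vertices_subset_body by blast
    then show ?thesis
      using vertex_in_hull[OF conforming_nondegenerate[OF assms(1) F(1)]] F(2) by blast
  qed (use F in simp)
qed

lemma moe_not_node:
  assumes "conforming U" "E \<in> U"
  shows "moe E \<notin> nodes U"
  using assms conforming_vertices_proper moe_not_vertex conforming_nondegenerate moe_in_oe oe_subset_body
  by blast

text \<open>The base of a child consists of old nodes, whereas its newest vertex is new. So a base that is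
  contained in the vertices of another child is contained in the base of that child.\<close>

lemma matching_refine_all:
  assumes U: "conforming U" "matching U"
  shows "matching (refine_all U)"
  unfolding matching_def
proof (intro ballI impI)
  fix C D assume "C \<in> refine_all U" "D \<in> refine_all U" and ne: "C \<noteq> D" and sub: "base C \<subseteq> vertices D"
  then obtain E F where *: "E \<in> U" "F \<in> U" "C \<in> children E" "D \<in> children F"
    by (auto simp: refine_all_def)
  have nd: "nondegenerate E" "nondegenerate F" using * U conforming_nondegenerate by auto
  have m: "moe E \<notin> vertices E" "moe F \<notin> nodes U" "moe E \<notin> nodes U"
    using moe_not_vertex[OF nd(1)] moe_not_node U * by auto
  obtain b where b: "b \<in> base E" "base C = {nv E, b}" using base_child[OF *(3)] .
  obtain c where c: "c \<in> base F" "base D = {nv F, c}" using base_child[OF *(4)] .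
  have "base C \<subseteq> nodes U" using b * base_subset_body(2)[of E] by (auto simp: nodes_def vertices_eq)
  then have "base C \<subseteq> base D"
    using sub m(2) nv_child[OF *(4)] by (auto simp: vertices_eq)
  moreover have "nv E \<noteq> b" using b nondegenerate_distinct[OF nd(1)] by (auto simp: base_def)
  ultimately show "base C = base D" using b(2) c(2) by auto
qed

text \<open>Near the midpoint of the common side \<open>[a, b]\<close>, two triangles on the same side of it overlap: the point \<open>z\<close>
  is the midpoint of \<open>[a, b]\<close>, moved a little towards \<open>c\<close>.\<close>

lemma same_side_overlap:
  assumes "orient a b c * orient a b d > 0"
  obtains z where "z \<in> convex hull {a, b, c}" "z \<in> convex hull {a, b, d}" "\<not> collinear {a, b, z}"
proof -
  define k where "k = orient a b c / orient a b d"
  define m where "m = midpoint a b"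
  have k: "k > 0" "k * orient a b d = orient a b c"
    using assms by (auto simp: k_def zero_less_mult_iff field_simps)
  have "a \<noteq> b" using assms by (auto simp: orient_def)
  have "orient a b (a + (c - m - k *\<^sub>R (d - m))) = orient a b c - k * orient a b d"
    by (simp add: orient_def m_def midpoint_def field_simps)
  then have "collinear {a, b, a + (c - m - k *\<^sub>R (d - m))}"
    using k(2) by (simp add: collinear_iff_orient)
  then have "a + (c - m - k *\<^sub>R (d - m)) \<in> affine hull {a, b}"
    using \<open>a \<noteq> b\<close> collinear_3_affine_hull by blast
  then obtain u v where uv: "u + v = 1" "a + (c - m - k *\<^sub>R (d - m)) = u *\<^sub>R a + v *\<^sub>R b"
    by (auto simp: affine_hull_2)
  have "u *\<^sub>R a + v *\<^sub>R b - a = v *\<^sub>R (b - a)"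
  proof -
    have "u = 1 - v" using uv(1) by simp
    show ?thesis unfolding \<open>u = 1 - v\<close> by (simp add: algebra_simps)
  qed
  then have "c - m - k *\<^sub>R (d - m) = v *\<^sub>R (b - a)"
    using uv(2) by (metis add_diff_cancel_left')
  then have c: "c - m = k *\<^sub>R (d - m) + v *\<^sub>R (b - a)"
    by (metis diff_add_cancel add.commute)
  \<comment> \<open>small enough for the weights of \<open>a\<close> and \<open>b\<close> below to be nonnegative\<close>
  define e where "e = 1 / (k + 2 * \<bar>v\<bar> + 1)"
  have e: "0 < e" "e \<le> 1" "e * k + 2 * (e * \<bar>v\<bar>) \<le> 1"
    using k(1) by (auto simp: e_def divide_simps) 
  have ev: "\<bar>e * v\<bar> \<le> (1 - e * k) / 2" using e by (simp add: abs_mult)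
  define z where "z = m + e *\<^sub>R (c - m)"
  have m: "m = (1/2) *\<^sub>R a + (1/2) *\<^sub>R b" by (simp add: m_def midpoint_def algebra_simps)
  have "z = ((1 - e) / 2) *\<^sub>R a + ((1 - e) / 2) *\<^sub>R b + e *\<^sub>R c"
    by (simp add: z_def m vec_eq_iff field_simps)
  then have 1: "z \<in> convex hull {a, b, c}"
    unfolding convex_hull_3 using e
    by (intro CollectI exI[of _ "(1 - e) / 2"] exI[of _ e]) (simp add: field_simps)
  have "z = m + e *\<^sub>R (k *\<^sub>R (d - m) + v *\<^sub>R (b - a))" unfolding z_def c ..
  also have "\<dots> = ((1 - e * k) / 2 - e * v) *\<^sub>R a + ((1 - e * k) / 2 + e * v) *\<^sub>R b + (e * k) *\<^sub>R d"
    unfolding m by (simp add: vec_eq_iff field_simps)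
  finally have z: "z = ((1 - e * k) / 2 - e * v) *\<^sub>R a + ((1 - e * k) / 2 + e * v) *\<^sub>R b + (e * k) *\<^sub>R d" .
  have 2: "z \<in> convex hull {a, b, d}"
    unfolding convex_hull_3 using e ev k
    by (intro CollectI exI[of _ "(1 - e * k) / 2 - e * v"] exI[of _ "(1 - e * k) / 2 + e * v"] exI[of _ "e * k"])
       (use z in \<open>auto simp: abs_le_iff field_simps\<close>)
  have "orient a b z = e * orient a b c"
    by (simp add: z_def m orient_def field_simps)
  moreover have "orient a b c \<noteq> 0" using assms by auto
  ultimately have 3: "\<not> collinear {a, b, z}"
    using e(1) by (simp add: collinear_iff_orient)
  show thesis using that[OF 1 2 3] .
qed

lemma common_edge_opposite_sides:
  assumes U: "conforming U" "E \<in> U" "F \<in> U" "E \<noteq> F"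
    and E: "vertices E = {a, b, c}" and F: "vertices F = {a, b, d}"
  shows "orient a b c * orient a b d < 0"
proof -
  have "orient a b c \<noteq> 0" "orient a b d \<noteq> 0"
    using conforming_nondegenerate[OF U(1,2)] conforming_nondegenerate[OF U(1,3)]
    unfolding nondegenerate_def E F collinear_iff_orient by simp_all
  moreover have "\<not> orient a b c * orient a b d > 0"
  proof
    assume "orient a b c * orient a b d > 0"
    then obtain z where z: "z \<in> body E" "z \<in> body F" "\<not> collinear {a, b, z}"
      using same_side_overlap unfolding body_def E F by metis
    have "{a, b, z} \<subseteq> body E \<inter> body F"
      using z(1,2) vertices_subset_body[of E] vertices_subset_body[of F] by (simp add: E F)
    then show False using conformingD(2)[OF U] z(3) collinear_subset by blast
  qed
  ultimately show ?thesis by (metis linorder_neqE_linordered_idom mult_eq_0_iff)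
qed

text \<open>If the point is not a node, the three elements have two vertices \<open>a\<close> and \<open>b\<close> in common, and two
  of their three third vertices lie on the same side of the line through \<open>a\<close> and \<open>b\<close>.\<close>

lemma three_elements_meet_in_node:
  assumes U: "conforming U" and mem: "E \<in> U" "F \<in> U" "G \<in> U"
    and ne: "E \<noteq> F" "E \<noteq> G" "F \<noteq> G"
    and x: "x \<in> body E" "x \<in> body F" "x \<in> body G"
  shows "x \<in> nodes U"
proof -
  define S where "S = (vertices E \<inter> vertices F) \<inter> (vertices E \<inter> vertices G)"
  have "x \<in> convex hull (vertices E \<inter> vertices F) \<inter> convex hull (vertices E \<inter> vertices G)"
    using conformingD(1)[OF U mem(1,2) ne(1)] conformingD(1)[OF U mem(1,3) ne(2)] x by blast
  then have xS: "x \<in> convex hull S"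
    unfolding S_def
    using hull_Int_hull[OF conforming_nondegenerate[OF U mem(1)], of "vertices E \<inter> vertices F" "vertices E \<inter> vertices G"]
    by simp
  show ?thesis
  proof (cases "\<exists>a\<in>S. \<exists>b\<in>S. a \<noteq> b")
    case True
    then obtain a b where ab: "a \<in> S" "b \<in> S" "a \<noteq> b" by blast
    have third: "\<exists>c. vertices X = {a, b, c}" if "a \<in> vertices X" "b \<in> vertices X" for X
      using that ab(3) by (auto simp: vertices_def)
    obtain c d e where "vertices E = {a, b, c}" "vertices F = {a, b, d}" "vertices G = {a, b, e}"
      using third ab unfolding S_def by (metis Int_iff)
    then have neg: "orient a b c * orient a b d < 0" "orient a b c * orient a b e < 0"
        "orient a b d * orient a b e < 0"
      using common_edge_opposite_sides[OF U] mem ne by auto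
    then show ?thesis by (auto simp: mult_less_0_iff)
  next
    case False
    moreover have "S \<noteq> {}" using xS by auto
    ultimately obtain a where "S = {a}" by blast
    then have "x \<in> S" using xS by simp
    then show ?thesis using mem by (auto simp: S_def nodes_def)
  qed
qed

lemma sides_hull:
  assumes "s \<in> sides E"
  obtains p q where "s = closed_segment p q" "{p, q} \<subseteq> vertices E"
  using assms by (auto simp: sides_def vertices_def oe_def)

lemma initial_mesh_conforming:
  assumes "initial_mesh \<Omega> T0"
  shows "conforming T0"
proof -
  have T0: "conforming_triangulation (closure \<Omega>) T0" using assms by (simp add: initial_mesh_def)
  have nd: "nondegenerate E" if "E \<in> T0" for E
    using T0 that by (simp add: conforming_triangulation_def nondegenerate_def)
  have "body E \<inter> body F = convex hull (vertices E \<inter> vertices F) \<and> collinear (body E \<inter> body F)"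
    if EF: "E \<in> T0" "F \<in> T0" "E \<noteq> F" for E F
  proof -
    have V: "vertices E \<inter> vertices F \<subseteq> body E \<inter> body F" using vertices_subset_body by blast
    consider "body E \<inter> body F = {}" | x where "x \<in> vertices E \<inter> vertices F" "body E \<inter> body F = {x}"
      | "body E \<inter> body F \<in> sides E" "body E \<inter> body F \<in> sides F"
      using T0 EF unfolding conforming_triangulation_def by blast
    then show ?thesis
    proof cases
      case 1
      then have "vertices E \<inter> vertices F = {}" using V by blast
      then show ?thesis unfolding 1 by simp
    next
      case (2 x)
      then have "vertices E \<inter> vertices F = {x}" using V by blast
      then show ?thesis unfolding 2(2) by simp
    next
      case 3
      obtain p q where pq: "body E \<inter> body F = closed_segment p q" "{p, q} \<subseteq> vertices E"
        using sides_hull[OF 3(1)] .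
      obtain p' q' where "body E \<inter> body F = closed_segment p' q'" "{p', q'} \<subseteq> vertices F"
        using sides_hull[OF 3(2)] .
      then have "{p, q} \<subseteq> vertices F" using pq(1) by simp
      moreover have "vertices E \<inter> vertices F \<subseteq> {p, q}"
        using V vertex_in_hull[OF nd[OF EF(1)] pq(2)] unfolding pq(1) segment_convex_hull by blast
      ultimately have "vertices E \<inter> vertices F = {p, q}" using pq(2) by blast
      then show ?thesis unfolding pq(1)
        by (simp only: segment_convex_hull[symmetric] collinear_closed_segment simp_thms)
    qed
  qed
  then show ?thesis using nd unfolding conforming_def by blast
qed

lemma initial_mesh_matching:
  assumes "initial_mesh \<Omega> T0"
  shows "matching T0"
  unfolding matching_def
proof (intro ballI impI)
  fix E F assume EF: "E \<in> T0" "F \<in> T0" "E \<noteq> F" and sub: "base E \<subseteq> vertices F"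
  have "nondegenerate E" using assms EF(1)
    by (simp add: initial_mesh_def conforming_triangulation_def nondegenerate_def)
  then have "base1 E \<noteq> base2 E" by (rule nondegenerate_distinct)
  then have "oe E \<in> sides F" using sub
    by (auto simp: base_def vertices_def sides_def oe_def closed_segment_commute)
  moreover have "oe E \<in> sides E" by (simp add: sides_def)
  ultimately have "oe E = oe F"
    using assms EF unfolding initial_mesh_def by blast
  then show "base E = base F" by (simp add: oe_def base_def)
qed

section \<open>The uniform refinements\<close>

lemma generated_trans:
  assumes "generated {G} k H" "generated T n G"
  shows "generated T (n + k) H"
  using assms by induction (auto intro: generated.intros)

lemma generated_split:
  assumes "generated T (n + k) H"
  obtains G where "generated T n G" "generated {G} k H"
  using assms
proof (induction k arbitrary: H thesis)
  case 0
  then show ?case by (auto intro: generated.init)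
next
  case (Suc k)
  from Suc.prems(2) obtain E where "generated T (n + k) E" "H \<in> children E"
    by (auto elim: generated.cases)
  then show ?case using Suc by (metis generated.child)
qed

lemma body_generated: "generated {G} k H \<Longrightarrow> body H \<subseteq> body G"
  by (induction rule: generated.induct) (use body_child in blast)+

lemma area2_generated: "generated {G} k H \<Longrightarrow> area2 H = area2 G / 2 ^ k"
  by (induction rule: generated.induct) (auto simp: area2_child)

lemma generated_cover:
  assumes "x \<in> body G"
  obtains H where "generated {G} k H" "x \<in> body H"
proof -
  have "\<exists>H. generated {G} k H \<and> x \<in> body H"
  proof (induction k)
    case 0
    then show ?case using assms by (auto intro: generated.init)
  next
    case (Suc k)
    then show ?case by (metis children_cover generated.child)
  qed
  then show thesis using that by blast
qed

lemma generated_Suc: "{E. generated T (Suc n) E} = refine_all {E. generated T n E}"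
  by (auto simp: refine_all_def intro: generated.child elim: generated.cases)

lemma generated_0: "generated T 0 E \<longleftrightarrow> E \<in> T"
  by (auto intro: generated.init elim: generated.cases)

text \<open>The properties of the initial mesh that carry over to its uniform refinements, and through them
  to all statements about levels and indices.\<close>

locale matched_initial_mesh =
  fixes T0 :: mesh
  assumes conforming_T0: "conforming T0" and matching_T0: "matching T0"
begin

abbreviation gen :: "nat \<Rightarrow> triangle \<Rightarrow> bool" where
  "gen \<equiv> generated T0"

text \<open>The nodes of the uniform refinement of level \<open>n\<close>.\<close>

definition N :: "nat \<Rightarrow> point set" where
  "N n = nodes {E. gen n E}"

lemma uniform: "conforming {E. gen n E}" "matching {E. gen n E}"
proof -
  have "conforming {E. gen n E} \<and> matching {E. gen n E}"
  proof (induction n)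
    case 0
    then show ?case using conforming_T0 matching_T0 by (simp add: generated_0)
  next
    case (Suc n)
    then show ?case unfolding generated_Suc using conforming_refine_all matching_refine_all by blast
  qed
  then show "conforming {E. gen n E}" "matching {E. gen n E}" by auto
qed

lemma gen_nondegenerate: "gen n E \<Longrightarrow> nondegenerate E"
  using conforming_nondegenerate[OF uniform(1)] by simp

lemma gen_Int:
  assumes "gen n E" "gen n F" "E \<noteq> F"
  shows "body E \<inter> body F = convex hull (vertices E \<inter> vertices F)" "collinear (body E \<inter> body F)"
  using conformingD[OF uniform(1)[of n], of E F] assms by auto

lemma gen_base_eq: "gen n E \<Longrightarrow> gen n F \<Longrightarrow> base E \<subseteq> vertices F \<Longrightarrow> base E = base F"
  using matchingD[OF uniform(2)[of n], of E F] by (cases "E = F") auto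

text \<open>Two distinct elements of a conforming mesh meet in a collinear set. It follows that the ancestor of an
  element on a given level is unique.\<close>

lemma same_level_eq:
  assumes "gen n E" "gen n F" "body H \<subseteq> body E" "body H \<subseteq> body F" "nondegenerate H"
  shows "E = F"
proof (rule ccontr)
  assume "E \<noteq> F"
  moreover have "vertices H \<subseteq> body E \<inter> body F" using assms vertices_subset_body by blast
  ultimately show False using gen_Int(2)[OF assms(1,2)] assms(5) collinear_subset
    unfolding nondegenerate_def by blast
qed

lemma gen_level_unique: 
  assumes "gen n E" "gen m E"
  shows "n = m"
proof -
  have "n = m" if "n \<le> m" "gen n E" "gen m E" for n m
  proof -
    have "gen (n + (m - n)) E" using that by simp
    then obtain G where G: "gen n G" "generated {G} (m - n) E" by (rule generated_split)
    have "G = E" using same_level_eq[OF G(1) that(2) body_generated[OF G(2)]]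
      gen_nondegenerate that by blast
    then have "area2 E = area2 E / 2 ^ (m - n)" using area2_generated[OF G(2)] by simp
    moreover have "area2 E > 0" using gen_nondegenerate that(2) by (simp add: nondegenerate_iff_area)
    ultimately have "(2::real) ^ (m - n) = 1" by (simp add: field_simps)
    then have "m - n = 0" using one_less_power[of "2::real" "m - n"] by (cases "m - n") auto
    then show ?thesis using that(1) by simp
  qed
  then show ?thesis using assms by (metis nle_le)
qed

lemma level_eq: "gen n E \<Longrightarrow> level T0 E = n"
  unfolding level_def by (rule Least_equality) (auto dest: gen_level_unique)

lemma N_Suc: "N (Suc n) = N n \<union> {moe G | G. gen n G}"
proof -
  have "N (Suc n) = (\<Union>G\<in>{E. gen n E}. \<Union>C\<in>children G. vertices C)"
    unfolding N_def generated_Suc refine_all_def nodes_def by blast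
  then show ?thesis unfolding vertices_children N_def nodes_def by auto
qed

lemma N_mono: "n \<le> m \<Longrightarrow> N n \<subseteq> N m"
  by (rule lift_Suc_mono_le[of N]) (auto simp: N_Suc)

lemma vertices_N: "gen n E \<Longrightarrow> vertices E \<subseteq> N n"
  by (auto simp: N_def nodes_def)

lemma N_vertex:
  assumes "x \<in> N n" "gen m E" "n \<le> m" "x \<in> body E"
  shows "x \<in> vertices E"
  using conforming_vertices_proper[OF uniform(1)[of m]] N_mono[OF assms(3)] assms
  unfolding N_def by blast

lemma moe_notin_N: "gen n E \<Longrightarrow> moe E \<notin> N n"
  using moe_not_node[OF uniform(1)[of n]] by (simp add: N_def)

lemma moe_in_N_Suc: "gen n E \<Longrightarrow> moe E \<in> N (Suc n)"
  by (auto simp: N_Suc)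

lemma three_elements_N:
  assumes "gen n E" "gen n F" "gen n G" "E \<noteq> F" "E \<noteq> G" "F \<noteq> G"
    and "x \<in> body E" "x \<in> body F" "x \<in> body G"
  shows "x \<in> N n"
  using three_elements_meet_in_node[OF uniform(1)[of n], of E F G x] assms by (simp add: N_def)

lemma moe_in_same_level:
  assumes "gen n E" "gen n F" "moe E \<in> body F"
  shows "base E = base F"
proof (cases "E = F")
  case False
  have "moe E \<in> body E" using moe_in_oe oe_subset_body by blast
  then have "moe E \<in> convex hull (vertices E \<inter> vertices F)"
    using gen_Int(1)[OF assms(1,2) False] assms(3) by blast
  then have "base E \<subseteq> vertices E \<inter> vertices F"
    by (intro moe_in_hull_imp_base[OF gen_nondegenerate[OF assms(1)]]) auto
  then show ?thesis using gen_base_eq[OF assms(1,2)] by blast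
qed simp

text \<open>The endpoints of the side at whose midpoint \<open>x\<close> is created. The union runs over all elements of any
  level whose bisection would create \<open>x\<close>; these all have the same base.\<close>

definition parents :: "point \<Rightarrow> point set" where
  "parents x = (\<Union>G\<in>{G. (\<exists>n. gen n G) \<and> moe G = x}. base G)"

text \<open>The midpoint of \<open>oe G\<close> becomes a node exactly when the level rises from that of \<open>G\<close> to the next,
  so both elements have the same level, and there conformity applies.\<close>

lemma moe_eq_imp_base_eq:
  assumes "gen n G" "gen m H" "moe G = moe H"
  shows "base G = base H"
proof -
  have "n = m"
    using moe_notin_N moe_in_N_Suc N_mono assms by (metis Suc_leI linorder_neqE_nat subsetD)
  then have "gen n H" using assms(2) by simp
  moreover have "moe G \<in> body H" unfolding assms(3) using moe_in_oe oe_subset_body by blast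
  ultimately show ?thesis by (rule moe_in_same_level[OF assms(1)])
qed

lemma parents_moe: "gen n G \<Longrightarrow> parents (moe G) = base G"
  using moe_eq_imp_base_eq unfolding parents_def by blast

section \<open>Meshes obtained by bisection\<close>

lemma bisect_cases:
  assumes "A \<in> bisect T E"
  obtains "A \<in> T" "A \<noteq> E" | "A \<in> children E"
  using assms by (auto simp: bisect_def)

lemma mesh_gen:
  assumes "refinement T0 T" "E \<in> T"
  obtains n where "gen n E"
proof -
  have "\<exists>n. gen n E" using assms
  proof (induction arbitrary: E)
    case refl
    then show ?case by (auto intro: generated.init)
  next
    case (step T' F)
    then show ?case by (meson bisect_cases generated.child)
  qed
  then show thesis using that by blast
qed

text \<open>No element of the initial mesh shares a descendant with another one, and a bisection only splits the set of
  descendants of one element between its two children.\<close>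

lemma mesh_disjoint:
  assumes "refinement T0 T" "E \<in> T" "F \<in> T" "generated {E} i H" "generated {F} j H"
  shows "E = F"
  using assms
proof (induction arbitrary: E F i j)
  case refl
  have EF: "gen 0 E" "gen 0 F" using refl by (auto simp: generated_0)
  show ?case
    using same_level_eq[OF EF body_generated[OF refl(3)] body_generated[OF refl(4)]]
      generated_trans[OF refl(3) EF(1)] gen_nondegenerate by blast
next
  case (step T' D)
  obtain n where n: "gen n D" using mesh_gen[OF step.hyps] .
  have child: "generated {D} (Suc k) H" if "A \<in> children D" "generated {A} k H" for A k
    using generated_trans[OF that(2), of "{D}" "Suc 0"] that(1)
      generated.child[OF generated.init, of D "{D}" A] by simp
  consider "E \<in> T'" "E \<noteq> D" "F \<in> T'" "F \<noteq> D" | "E \<in> T'" "E \<noteq> D" "F \<in> children D"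
    | "E \<in> children D" "F \<in> T'" "F \<noteq> D" | "E \<in> children D" "F \<in> children D"
    using step.prems(1,2) unfolding bisect_def by blast
  then show ?case
  proof cases
    case 1
    then show ?thesis using step.IH step.prems by blast
  next
    case 2
    then show ?thesis using step.IH[of E D] step.hyps(2) step.prems child by blast
  next
    case 3
    then show ?thesis using step.IH[of D F] step.hyps(2) step.prems child by blast
  next
    case 4
    then have EF: "gen (Suc n) E" "gen (Suc n) F" using n by (auto intro: generated.child)
    show ?thesis
      using same_level_eq[OF EF body_generated[OF step.prems(3)] body_generated[OF step.prems(4)]]
        generated_trans[OF step.prems(3) EF(1)] gen_nondegenerate by blast
  qed
qed

lemma mesh_antichain:
  assumes "refinement T0 T" "E \<in> T" "F \<in> T" "generated {E} i F"
  shows "E = F"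
  using mesh_disjoint[OF assms(1-4), of 0] generated.init[of F "{F}"] by simp

lemma nodes_bisect: "E \<in> T \<Longrightarrow> nodes (bisect T E) = insert (moe E) (nodes T)"
proof -
  assume E: "E \<in> T"
  have "nodes (bisect T E) = nodes (T - {E}) \<union> insert (moe E) (vertices E)"
    unfolding vertices_children[symmetric] by (auto simp: nodes_def bisect_def)
  also have "\<dots> = insert (moe E) (nodes T)" using E by (auto simp: nodes_def)
  finally show ?thesis .
qed

lemma refinement_nodes: "refinement T1 T2 \<Longrightarrow> nodes T1 \<subseteq> nodes T2"
  by (induction rule: refinement.induct) (auto simp: nodes_bisect)

lemma nodes_N:
  assumes "refinement T0 T" "x \<in> nodes T"
  obtains n where "x \<in> N n"
  using assms mesh_gen vertices_N unfolding nodes_def by (metis UN_E subsetD)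

lemma N_0: "N 0 = nodes T0"
  by (simp add: N_def generated_0)

lemma created_on_parents:
  assumes "created_on T0 T x p q"
  shows "parents x = {p, q}" "p \<in> nodes T" "q \<in> nodes T"
proof -
  obtain T1 F where T1: "refinement T0 T1" "F \<in> T1" "refinement (bisect T1 F) T"
    and x: "x = moe F" "p = base1 F" "q = base2 F"
    using assms by (auto simp: created_on_def)
  obtain n where "gen n F" using mesh_gen[OF T1(1,2)] .
  then show "parents x = {p, q}" by (simp add: x parents_moe base_def)
  have "vertices F \<subseteq> nodes T"
    using refinement_nodes[OF T1(3)] T1(2) unfolding nodes_bisect[OF T1(2)] by (auto simp: nodes_def)
  then show "p \<in> nodes T" "q \<in> nodes T" by (auto simp: x vertices_def)
qed

lemma created_on_ex:
  assumes "refinement T0 T" "x \<in> nodes T" "x \<notin> N 0"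
  obtains p q where "created_on T0 T x p q"
proof -
  have "\<exists>p q. created_on T0 T x p q" using assms
  proof (induction)
    case refl
    then show ?case by (simp add: N_0)
  next
    case (step T' E)
    show ?case
    proof (cases "x \<in> nodes T'")
      case True
      then obtain p q where "created_on T0 T' x p q" using step by blast
      then show ?thesis using step.hyps refinement.step unfolding created_on_def by metis
    next
      case False
      then have "x = moe E" using step by (simp add: nodes_bisect)
      then have "created_on T0 (bisect T' E) x (base1 E) (base2 E)"
        unfolding created_on_def using False step.hyps refinement.refl by metis
      then show ?thesis by blast
    qed
  qed
  then show thesis using that by blast
qed

lemma parents_subset_nodes:
  assumes "refinement T0 T" "x \<in> nodes T" "x \<notin> N 0"
  shows "parents x \<subseteq> nodes T"
proof -
  obtain p q where "created_on T0 T x p q" using created_on_ex[OF assms] .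
  then show ?thesis using created_on_parents by auto
qed

lemma parents_subset_N:
  assumes "x \<in> N (Suc n)" "x \<notin> N n"
  shows "parents x \<subseteq> N n"
proof -
  obtain G where G: "gen n G" "x = moe G" using assms by (auto simp: N_Suc)
  show ?thesis unfolding G(2) parents_moe[OF G(1)]
    using base_subset_body(2) vertices_N[OF G(1)] by blast
qed

text \<open>Induction along the recursion of the global index. It terminates because the parents of a node
  are nodes of a smaller level.\<close>

lemma node_induct [consumes 2, case_names node]:
  assumes "refinement T0 T" "x \<in> nodes T"
    and step: "\<And>x. x \<in> nodes T \<Longrightarrow> (\<And>p. x \<notin> N 0 \<Longrightarrow> p \<in> parents x \<Longrightarrow> p \<in> nodes T \<and> P p) \<Longrightarrow> P x"
  shows "P x"
proof -
  obtain n where "x \<in> N n" using nodes_N[OF assms(1,2)] .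
  then show ?thesis using assms(2)
  proof (induction n arbitrary: x)
    case 0
    then show ?case using step by blast
  next
    case (Suc n)
    show ?case
    proof (cases "x \<in> N n")
      case False
      show ?thesis
        using step[OF Suc.prems(2)] parents_subset_N[OF Suc.prems(1) False] Suc.IH
          parents_subset_nodes[OF assms(1) Suc.prems(2)] by blast
    qed (use Suc in blast)
  qed
qed

section \<open>The global index\<close>

lemma proper_if_N0:
  assumes "refinement T0 T" "x \<in> nodes T" "x \<in> N 0"
  shows "proper_node T x"
  unfolding proper_node_def using assms N_vertex mesh_gen by (metis le0)

lemma has_global_index_unique:
  assumes "has_global_index T0 T x n" "has_global_index T0 T x n'"
  shows "n = n'"
  using assms
proof (induction arbitrary: n')
  case (proper x)
  then show ?case by (auto simp: hanging_node_def elim: has_global_index.cases)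
next
  case (hanging x p q m n)
  from hanging.prems show ?case
  proof (cases rule: has_global_index.cases)
    case proper
    then show ?thesis using hanging.hyps by (simp add: hanging_node_def)
  next
    case h: (hanging p' q' m' n'')
    have "{p, q} = {p', q'}"
      using created_on_parents(1)[OF hanging.hyps(2)] created_on_parents(1)[OF h(3)] by simp
    then consider "p' = p" "q' = q" | "p' = q" "q' = p" by (auto simp: doubleton_eq_iff)
    then show ?thesis
    proof cases
      case 1
      then show ?thesis using hanging.IH h by metis
    next
      case 2
      then have "m = n''" "n = m'" using hanging.IH h(4,5) by auto
      then show ?thesis using h(1) by (simp add: max.commute)
    qed
  qed
qed

lemma has_global_index_ex:
  assumes "refinement T0 T" "x \<in> nodes T"
  shows "\<exists>n. has_global_index T0 T x n"
  using assms
proof (induction rule: node_induct)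
  case (node x)
  show ?case
  proof (cases "proper_node T x")
    case True
    then show ?thesis by (blast intro: has_global_index.proper)
  next
    case False
    then have x0: "x \<notin> N 0" using proper_if_N0 assms(1) node(1) by blast
    then obtain p q where pq: "created_on T0 T x p q" using created_on_ex[OF assms(1) node(1)] by blast
    then have "parents x = {p, q}" by (rule created_on_parents)
    then obtain m n where "has_global_index T0 T p m" "has_global_index T0 T q n"
      using node(2)[OF x0] by blast
    then show ?thesis
      using has_global_index.hanging[OF _ pq] False node(1) by (auto simp: hanging_node_def)
  qed
qed

lemma global_index_eqI: "has_global_index T0 T x n \<Longrightarrow> global_index T0 T x = n"
  unfolding global_index_def using has_global_index_unique by (intro the_equality) auto

lemma has_global_index:
  "refinement T0 T \<Longrightarrow> x \<in> nodes T \<Longrightarrow> has_global_index T0 T x (global_index T0 T x)"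
  using has_global_index_ex global_index_eqI by metis

lemma global_index_proper: "proper_node T x \<Longrightarrow> global_index T0 T x = 0"
  by (simp add: global_index_eqI has_global_index.proper)

lemma global_index_hanging:
  assumes "refinement T0 T" "hanging_node T x"
  obtains p q where "parents x = {p, q}" "p \<in> nodes T" "q \<in> nodes T"
    "global_index T0 T x = Suc (max (global_index T0 T p) (global_index T0 T q))"
proof -
  have x: "x \<in> nodes T" "\<not> proper_node T x" using assms(2) by (auto simp: hanging_node_def)
  obtain p q where pq: "created_on T0 T x p q"
    using created_on_ex[OF assms(1) x(1)] proper_if_N0[OF assms(1) x(1)] x(2) by blast
  note par = created_on_parents[OF pq]
  have "global_index T0 T x = max (global_index T0 T p) (global_index T0 T q) + 1"
    by (rule global_index_eqI has_global_index.hanging assms pq has_global_index par)+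
  then show thesis using that[OF par] by simp
qed

lemma parent_index_less:
  assumes "refinement T0 T" "hanging_node T x" "p \<in> parents x"
  shows "global_index T0 T p < global_index T0 T x"
proof -
  obtain p' q' where "parents x = {p', q'}"
    "global_index T0 T x = Suc (max (global_index T0 T p') (global_index T0 T q'))"
    using global_index_hanging[OF assms(1,2)] by metis
  then show ?thesis using assms(3) by auto
qed

text \<open>An upper bound for proper and hanging nodes alike. It lets indices in two meshes be compared without
  knowing whether \<open>x\<close> is still hanging in the finer one.\<close>

lemma index_le_Suc_parents:
  assumes "refinement T0 T" "x \<in> nodes T" "\<And>p. p \<in> parents x \<Longrightarrow> global_index T0 T p \<le> k"
  shows "global_index T0 T x \<le> Suc k"
proof (cases "proper_node T x")
  case True
  then show ?thesis by (simp add: global_index_proper)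
next
  case False
  then have "hanging_node T x" using assms(2) by (simp add: hanging_node_def)
  then obtain p' q' where "parents x = {p', q'}"
    "global_index T0 T x = Suc (max (global_index T0 T p') (global_index T0 T q'))"
    using global_index_hanging[OF assms(1)] by metis
  then show ?thesis using assms(3) by simp
qed

lemma proper_node_bisect:
  assumes "refinement T0 T" "E \<in> T" "proper_node T x"
  shows "proper_node (bisect T E) x"
  unfolding proper_node_def
proof (intro conjI ballI impI)
  show "x \<in> nodes (bisect T E)" using assms by (simp add: nodes_bisect proper_node_def)
next
  fix C assume C: "C \<in> bisect T E" "x \<in> body C"
  obtain n where n: "gen n E" using mesh_gen[OF assms(1,2)] .
  from C(1) show "x \<in> vertices C"
  proof (cases rule: bisect_cases)
    case 1
    then show ?thesis using assms(3) C by (simp add: proper_node_def)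
  next
    case 2
    have "x \<in> vertices E" using body_child[OF 2] C(2) assms(2,3) unfolding proper_node_def by blast
    then have "x \<in> N n" using vertices_N[OF n] by blast
    then show ?thesis using N_vertex[of x n "Suc n" C] generated.child[OF n 2] C(2) by simp
  qed
qed

lemma global_index_bisect_le:
  assumes "refinement T0 T" "E \<in> T" "x \<in> nodes T"
  shows "global_index T0 (bisect T E) x \<le> global_index T0 T x"
  using assms(1,3)
proof (induction rule: node_induct)
  case (node x)
  let ?T = "bisect T E"
  have r: "refinement T0 ?T" using assms by (simp add: refinement.step)
  have xT: "x \<in> nodes ?T" using node(1) assms by (simp add: nodes_bisect)
  show ?case
  proof (cases "proper_node ?T x")
    case True
    then show ?thesis by (simp add: global_index_proper)
  next
    case False
    then have h: "hanging_node T x"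
      using proper_node_bisect[OF assms(1,2)] node(1) by (auto simp: hanging_node_def)
    then have x0: "x \<notin> N 0" using proper_if_N0[OF assms(1) node(1)] by (auto simp: hanging_node_def)
    have "global_index T0 ?T p \<le> global_index T0 T x - 1" if "p \<in> parents x" for p
      using node(2)[OF x0 that] parent_index_less[OF assms(1) h that] by linarith
    moreover have "global_index T0 T x > 0"
      using global_index_hanging[OF assms(1) h] by (metis zero_less_Suc)
    ultimately show ?thesis
      using index_le_Suc_parents[OF r xT, of "global_index T0 T x - 1"] by simp
  qed
qed

text \<open>Compare on the level of \<open>F\<close>, the element of the higher level. On this level \<open>x\<close> is not yet a node, but it
  belongs to \<open>F\<close>, to a descendant of \<open>E\<close>, and to an ancestor of an element that has \<open>x\<close> as a vertex.\<close>

lemma hanging_element_unique: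
  assumes T: "refinement T0 T" and x: "x \<in> nodes T"
    and E: "E \<in> T" "x \<in> body E" "x \<notin> vertices E" and F: "F \<in> T" "x \<in> body F" "x \<notin> vertices F"
  shows "E = F"
proof -
  have main: "E = F"
    if nm: "n \<le> m" and E: "gen n E" "E \<in> T" "x \<in> body E" "x \<notin> vertices E"
      and F: "gen m F" "F \<in> T" "x \<in> body F" "x \<notin> vertices F" for E F n m
  proof (rule ccontr)
    assume ne: "E \<noteq> F"
    have xm: "x \<notin> N m" using N_vertex F by blast
    obtain G where G: "G \<in> T" "x \<in> vertices G" using x by (auto simp: nodes_def)
    obtain k where k: "gen k G" using mesh_gen[OF T G(1)] .
    have "m \<le> k" using xm vertices_N[OF k] N_mono[of k m] G(2) by (metis nle_le subsetD)
    then have "gen (m + (k - m)) G" using k by simp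
    then obtain G' where G': "gen m G'" "generated {G'} (k - m) G" by (rule generated_split)
    have xG': "x \<in> body G'" using body_generated[OF G'(2)] vertices_subset_body G(2) by blast
    obtain E' where E': "generated {E} (m - n) E'" "x \<in> body E'"
      using generated_cover[OF E(3)] .
    have gE': "gen m E'" using generated_trans[OF E'(1) E(1)] nm by simp
    have "E' \<noteq> F" using mesh_antichain[OF T E(2) F(2)] E'(1) ne by blast
    moreover have "G' \<noteq> F" using mesh_antichain[OF T F(2) G(1)] G'(2) G(2) F(4) by blast
    moreover have "E' \<noteq> G'"
      using mesh_antichain[OF T E(2) G(1) generated_trans[OF G'(2)]] E'(1) G(2) E(4) by blast
    ultimately show False
      using three_elements_N[of m E' F G' x] gE' F(1) G'(1) E'(2) F(3) xG' xm by blast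
  qed
  obtain n where n: "gen n E" using mesh_gen[OF T E(1)] .
  obtain m where m: "gen m F" using mesh_gen[OF T F(1)] .
  show ?thesis using main[OF _ n E m F] main[OF _ m F n E] by (metis nle_le)
qed

section \<open>Facing elements\<close>

text \<open>If \<open>F\<close> had a higher level than \<open>E\<close>, the midpoint of \<open>oe E\<close> would be a vertex of \<open>F\<close>, but a vertex cannot lie in
  the interior of a segment contained in \<open>F\<close>.\<close>

lemma oe_in_body_level_le:
  assumes "oe E \<subseteq> body F" "gen n E" "gen m F"
  shows "m \<le> n"
proof (rule ccontr)
  assume "\<not> m \<le> n"
  then have "moe E \<in> N m" using moe_in_N_Suc[OF assms(2)] N_mono[of "Suc n" m] by auto
  moreover have "moe E \<in> body F" using moe_in_oe assms(1) by blast
  ultimately have v: "moe E \<in> vertices F" using N_vertex assms(3) by blast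
  have "base E \<subseteq> body F" using assms(1) hull_subset[of "base E" convex] unfolding oe_eq_hull by blast
  then have "base1 E \<in> convex hull {moe E}"
    using midpoint_in_face(1)[OF gen_nondegenerate[OF assms(3)], of "{moe E}" "base1 E" "base2 E"] v
    by (simp add: base_def moe_def)
  then show False using moe_not_vertex[OF gen_nondegenerate[OF assms(2)]] by (simp add: vertices_def)
qed

lemma facing_unique:
  assumes T: "refinement T0 T" and E: "E \<in> T" and F: "F \<in> T" "F \<noteq> E" "oe E \<subseteq> body F"
    and G: "G \<in> T" "G \<noteq> E" "oe E \<subseteq> body G"
  shows "F = G"
proof (rule ccontr)
  assume ne: "F \<noteq> G"
  obtain n where n: "gen n E" using mesh_gen[OF T E] .
  have desc: "\<exists>X' k. gen n X' \<and> generated {X} k X' \<and> moe E \<in> body X'"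
    if X: "X \<in> T" "oe E \<subseteq> body X" for X
  proof -
    obtain m where m: "gen m X" using mesh_gen[OF T X(1)] .
    have "m \<le> n" using oe_in_body_level_le[OF X(2) n m] .
    moreover obtain X' where "generated {X} (n - m) X'" "moe E \<in> body X'"
      using generated_cover[of "moe E" X] X(2) moe_in_oe by blast
    ultimately show ?thesis using generated_trans[OF _ m] by (metis le_add_diff_inverse)
  qed
  obtain F' i where F': "gen n F'" "generated {F} i F'" "moe E \<in> body F'" using desc F by blast
  obtain G' j where G': "gen n G'" "generated {G} j G'" "moe E \<in> body G'" using desc G by blast
  have "E \<noteq> F'" using mesh_antichain[OF T F(1) E] F'(2) F(2) by blast
  moreover have "E \<noteq> G'" using mesh_antichain[OF T G(1) E] G'(2) G(2) by blast
  moreover have "F' \<noteq> G'" using mesh_disjoint[OF T F(1) G(1)] F'(2) G'(2) ne by blast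
  moreover have "moe E \<in> body E" using moe_in_oe oe_subset_body by blast
  ultimately have "moe E \<in> N n" using three_elements_N[OF n F'(1) G'(1)] F'(3) G'(3) by blast
  then show False using moe_notin_N[OF n] by blast
qed

text \<open>The ancestor of \<open>E\<close> on the level of \<open>F\<close> meets \<open>F\<close> in a common face. Hence all of \<open>body E \<inter> body F\<close> lies
  in one proper face of \<open>F\<close>, even if \<open>oe E\<close> is only a small part of that side.\<close>

lemma facing_edge:
  assumes T: "refinement T0 T" and EF: "E \<in> T" "F \<in> T" "F \<noteq> E" "oe E \<subseteq> body F"
  obtains S where "S \<subseteq> vertices F" "body E \<inter> body F \<subseteq> convex hull S" "collinear (convex hull S)"
proof -
  obtain n where n: "gen n E" using mesh_gen[OF T EF(1)] .
  obtain m where m: "gen m F" using mesh_gen[OF T EF(2)] .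
  have "m \<le> n" using oe_in_body_level_le[OF EF(4) n m] .
  then have "gen (m + (n - m)) E" using n by simp
  then obtain E' where E': "gen m E'" "generated {E'} (n - m) E" by (rule generated_split)
  have "E' \<noteq> F" using mesh_antichain[OF T EF(2,1)] E'(2) EF(3) by blast
  note I = gen_Int[OF E'(1) m this]
  show thesis
  proof (rule that)
    show "body E \<inter> body F \<subseteq> convex hull (vertices E' \<inter> vertices F)"
      using body_generated[OF E'(2)] I(1) by blast
    show "collinear (convex hull (vertices E' \<inter> vertices F))" using I by simp
  qed simp
qed

lemma oe_subset_Int: "oe E \<subseteq> body F \<Longrightarrow> base E \<subseteq> body E \<inter> body F"
  using base_subset_body(1)[of E] hull_subset[of "base E" convex] unfolding oe_eq_hull by blast

lemma facingI:
  assumes T: "refinement T0 T" and EF: "E \<in> T" "F \<in> T" "F \<noteq> E" "oe E \<subseteq> body F"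
  shows "facing T E F"
proof -
  obtain n where n: "gen n E" using mesh_gen[OF T EF(1)] .
  obtain S where S: "body E \<inter> body F \<subseteq> convex hull S" "collinear (convex hull S)"
    using facing_edge[OF assms] by metis
  have "body E \<inter> body F \<subseteq> oe E"
  proof
    fix y assume y: "y \<in> body E \<inter> body F"
    then have "{base1 E, base2 E, y} \<subseteq> convex hull S"
      using S(1) oe_subset_Int[OF EF(4)] by (auto simp: base_def)
    then have "collinear {base1 E, base2 E, y}" using S(2) collinear_subset by blast
    then show "y \<in> oe E" using body_collinear_with_base[OF gen_nondegenerate[OF n]] y by blast
  qed
  then have "body E \<inter> body F = oe E" using EF(4) oe_subset_body by blast
  then show ?thesis using EF by (simp add: facing_def adjacent_def sides_def)
qed

lemma facing_oe_subset: "facing T E F \<Longrightarrow> oe E \<subseteq> body F"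
  by (auto simp: facing_def)

lemma compatible_facing_iff:
  assumes "refinement T0 T" "E \<in> T" "facing T E F"
  shows "compatible E F \<longleftrightarrow> nv F \<notin> affine hull (oe E)"
proof -
  obtain n where "gen n E" using mesh_gen[OF assms(1,2)] .
  then show ?thesis using assms(3) nv_notin_affine_oe[OF gen_nondegenerate]
    by (auto simp: compatible_def facing_def)
qed

lemma facing_compatible:
  assumes T: "refinement T0 T" and E: "E \<in> T" and f: "facing T E F" and c: "compatible E F"
  shows "oe E \<subseteq> oe F"
proof -
  have F: "F \<in> T" "F \<noteq> E" "oe E \<subseteq> body F" using f by (auto simp: facing_def)
  obtain n where n: "gen n E" using mesh_gen[OF T E] .
  obtain S where S: "S \<subseteq> vertices F" "body E \<inter> body F \<subseteq> convex hull S" "collinear (convex hull S)"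
    using facing_edge[OF T E F] .
  have "nv F \<notin> S"
  proof
    assume "nv F \<in> S"
    then have "{base1 E, base2 E, nv F} \<subseteq> convex hull S"
      using oe_subset_Int[OF F(3)] S(2) hull_subset[of S convex] by (auto simp: base_def)
    then have "collinear {base1 E, base2 E, nv F}" using S(3) collinear_subset by blast
    then have "nv F \<in> affine hull base E"
      unfolding base_def
      using collinear_3_affine_hull nondegenerate_distinct(3)[OF gen_nondegenerate[OF n]] by blast
    then show False using compatible_facing_iff[OF T E f] c
      by (simp add: oe_eq_hull affine_hull_convex_hull)
  qed
  then have "S \<subseteq> base F" using S(1) by (auto simp: vertices_eq)
  then have "convex hull S \<subseteq> oe F" unfolding oe_eq_hull by (rule hull_mono)
  then show ?thesis using S(2) f by (auto simp: facing_def)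
qed

text \<open>Here \<open>oe E\<close> lies in a side of \<open>F\<close> that contains \<open>nv F\<close>, and this side is opposite to the newest vertex of one
  of the children of \<open>F\<close>.\<close>

lemma facing_incompatible:
  assumes T: "refinement T0 T" and E: "E \<in> T" and f: "facing T E F" and c: "\<not> compatible E F"
  obtains C where "C \<in> children F" "oe E \<subseteq> oe C"
proof -
  have F: "F \<in> T" "F \<noteq> E" "oe E \<subseteq> body F" using f by (auto simp: facing_def)
  obtain m where m: "gen m F" using mesh_gen[OF T F(1)] .
  note nd = gen_nondegenerate[OF m]
  obtain S where S: "S \<subseteq> vertices F" "body E \<inter> body F \<subseteq> convex hull S" "collinear (convex hull S)"
    using facing_edge[OF T E F] .
  have oeS: "oe E \<subseteq> convex hull S" using S(2) f by (auto simp: facing_def)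
  have "\<not> S \<subseteq> base F"
  proof
    assume "S \<subseteq> base F"
    then have "convex hull S \<subseteq> oe F" unfolding oe_eq_hull by (rule hull_mono)
    then have "affine hull (oe E) \<subseteq> affine hull (oe F)" using oeS by (meson hull_mono subset_trans)
    then show False using compatible_facing_iff[OF T E f] c nv_notin_affine_oe[OF nd] by blast
  qed
  moreover have "\<not> vertices F \<subseteq> S"
    using S(3) nd hull_subset[of S convex] collinear_subset unfolding nondegenerate_def by (metis subset_trans)
  ultimately obtain b where b: "b \<in> base F" "S \<subseteq> {nv F, b}"
    using S(1) by (auto simp: vertices_def base_def)
  obtain C where C: "C \<in> children F" "base C = {nv F, b}" using child_with_base[OF b(1)] .
  have "convex hull S \<subseteq> oe C" unfolding oe_eq_hull C(2) using b(2) by (rule hull_mono)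
  then show thesis using that[OF C(1)] oeS by blast
qed

text \<open>On equal levels, both elements would have the same base, by matching in the uniform refinement, and
  would thus be compatible.\<close>

lemma facing_level:
  assumes T: "refinement T0 T" and E: "E \<in> T" and f: "facing T E F" and n: "gen n E" and m: "gen m F"
  shows "m \<le> n" "\<not> compatible E F \<Longrightarrow> m < n"
proof -
  show le: "m \<le> n" using oe_in_body_level_le[OF facing_oe_subset[OF f] n m] .
  assume c: "\<not> compatible E F"
  have "m \<noteq> n"
  proof
    assume "m = n"
    then have "base E = base F"
      using moe_in_same_level[OF n, of F] m moe_in_oe facing_oe_subset[OF f] by blast
    then have "oe E = oe F" by (simp add: oe_eq_hull)
    then show False using compatible_facing_iff[OF T E f] c nv_notin_affine_oe[OF gen_nondegenerate[OF m]]
      by simp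
  qed
  then show "m < n" using le by simp
qed

section \<open>Admissibility after bisections\<close>

lemma admissibleD:
  assumes "admissible T0 \<Lambda> T"
  shows "refinement T0 T" "x \<in> nodes T \<Longrightarrow> global_index T0 T x \<le> \<Lambda>"
  using assms by (auto simp: admissible_def)

lemma base_nodes: "E \<in> T \<Longrightarrow> base E \<subseteq> nodes T"
  using base_subset_body(2) by (auto simp: nodes_def)

lemma moe_index_le:
  assumes adm: "admissible T0 \<Lambda> T" and E: "E \<in> T" and k: "\<And>p. p \<in> base E \<Longrightarrow> global_index T0 T p \<le> k"
    and new: "moe E \<notin> nodes T"
  shows "moe_index T0 T E \<le> Suc k"
proof -
  have T: "refinement T0 T" using adm by (rule admissibleD)
  obtain n where n: "gen n E" using mesh_gen[OF T E] .
  have "global_index T0 (bisect T E) (moe E) \<le> Suc k"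
  proof (rule index_le_Suc_parents)
    show "refinement T0 (bisect T E)" using T E by (rule refinement.step)
    show "moe E \<in> nodes (bisect T E)" using E by (simp add: nodes_bisect)
    fix p assume "p \<in> parents (moe E)"
    then have "p \<in> base E" by (simp add: parents_moe[OF n])
    then show "global_index T0 (bisect T E) p \<le> k"
      using global_index_bisect_le[OF T E] base_nodes[OF E] k by (meson order_trans subsetD)
  qed
  then show ?thesis using new by (simp add: moe_index_def)
qed

lemma moe_index_le_Suc:
  assumes adm: "admissible T0 \<Lambda> T" and E: "E \<in> T"
  shows "moe_index T0 T E \<le> \<Lambda> + 1"
proof (cases "moe E \<in> nodes T")
  case True
  then show ?thesis using admissibleD(2)[OF adm] by (simp add: moe_index_def le_SucI)
next
  case False
  show ?thesis using moe_index_le[OF adm E _ False, of \<Lambda>] admissibleD(2)[OF adm] base_nodes[OF E] by auto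
qed

text \<open>Both endpoints of a side of the initial mesh are proper in every refinement, so the index of its midpoint
  is at most \<open>1\<close>.\<close>

lemma moe_index_level_0:
  assumes adm: "admissible T0 \<Lambda> T" and E: "E \<in> T" "gen 0 E" and "\<Lambda> \<ge> 1"
  shows "moe_index T0 T E \<le> \<Lambda>"
proof (cases "moe E \<in> nodes T")
  case True
  then show ?thesis using admissibleD(2)[OF adm] by (simp add: moe_index_def)
next
  case False
  have "global_index T0 T p \<le> 0" if "p \<in> base E" for p
  proof -
    have "p \<in> nodes T" "p \<in> N 0"
      using that base_nodes[OF E(1)] vertices_N[OF E(2)] base_subset_body(2) by blast+
    then show ?thesis using proper_if_N0[OF admissibleD(1)[OF adm]] global_index_proper by simp
  qed
  then have "moe_index T0 T E \<le> Suc 0" by (rule moe_index_le[OF adm E(1) _ False])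
  then show ?thesis using assms(4) by simp
qed

text \<open>A positive index means that \<open>moe E\<close> would hang on some element \<open>F\<close>. The level of \<open>F\<close> is at most that of
  \<open>E\<close>, and its descendant on the level of \<open>E\<close> at this midpoint has the same base as \<open>E\<close>.\<close>

lemma facing_ex:
  assumes adm: "admissible T0 \<Lambda> T" and E: "E \<in> T" and index: "moe_index T0 T E = \<Lambda> + 1"
  obtains F where "facing T E F"
proof -
  have T: "refinement T0 T" using adm by (rule admissibleD)
  obtain n where n: "gen n E" using mesh_gen[OF T E] .
  have "moe E \<notin> nodes T"
    using index admissibleD(2)[OF adm, of "moe E"] by (auto simp: moe_index_def)
  then have "global_index T0 (bisect T E) (moe E) \<noteq> 0" using index by (simp add: moe_index_def)
  then have "\<not> proper_node (bisect T E) (moe E)" using global_index_proper by auto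
  then obtain F where F: "F \<in> bisect T E" "moe E \<in> body F" "moe E \<notin> vertices F"
    using E by (auto simp: proper_node_def nodes_bisect)
  have FT: "F \<in> T" "F \<noteq> E"
    using F(1,3) nv_child[of F E] by (auto simp: bisect_def vertices_eq)
  obtain m where m: "gen m F" using mesh_gen[OF T FT(1)] .
  have "m \<le> n"
  proof (rule ccontr)
    assume "\<not> m \<le> n"
    then show False using N_vertex[OF moe_in_N_Suc[OF n] m] F by simp
  qed
  obtain F' where F': "generated {F} (n - m) F'" "moe E \<in> body F'" using generated_cover[OF F(2)] .
  have "gen n F'" using generated_trans[OF F'(1) m] \<open>m \<le> n\<close> by simp
  then have "base E = base F'" using moe_in_same_level[OF n] F'(2) by blast
  then have "oe E = oe F'" by (simp add: oe_eq_hull)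
  then have "oe E \<subseteq> body F" using body_generated[OF F'(1)] oe_subset_body[of F'] by simp
  then show thesis using that facingI[OF T E FT] by blast
qed

lemma admissible_bisect:
  assumes adm: "admissible T0 \<Lambda> T" and E: "E \<in> T" and index: "moe_index T0 T E \<le> \<Lambda>"
  shows "admissible T0 \<Lambda> (bisect T E)"
proof -
  have T: "refinement T0 T" using adm by (rule admissibleD)
  have "global_index T0 (bisect T E) x \<le> \<Lambda>" if "x \<in> nodes (bisect T E)" for x
  proof (cases "x \<in> nodes T")
    case True
    then show ?thesis using global_index_bisect_le[OF T E True] admissibleD(2)[OF adm True] by simp
  next
    case False
    then show ?thesis using index that E by (simp add: nodes_bisect moe_index_def)
  qed
  then show ?thesis using refinement.step[OF T E] by (simp add: admissible_def)
qed

text \<open>The midpoint hangs on \<open>E\<close> and therefore on no other element.\<close>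

lemma moe_proper_after_bisect:
  assumes T: "refinement T0 T" and E: "E \<in> T" and m: "moe E \<in> nodes T"
  shows "proper_node (bisect T E) (moe E)"
  unfolding proper_node_def
proof (intro conjI ballI impI)
  show "moe E \<in> nodes (bisect T E)" using E by (simp add: nodes_bisect)
  fix A assume A: "A \<in> bisect T E" "moe E \<in> body A"
  from A(1) show "moe E \<in> vertices A"
  proof (cases rule: bisect_cases)
    case 1
    obtain n where n: "gen n E" using mesh_gen[OF T E] .
    have "moe E \<in> body E" "moe E \<notin> vertices E"
      using moe_in_oe oe_subset_body moe_not_vertex[OF gen_nondegenerate[OF n]] by blast+
    then show ?thesis using hanging_element_unique[OF T m E] 1 A(2) by blast
  next
    case 2
    then show ?thesis using nv_child[OF 2] by (simp add: vertices_eq)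
  qed
qed

text \<open>Such a node is created by bisecting a descendant of \<open>F\<close>, and a face of \<open>F\<close> that contains a midpoint
  contains the endpoints. Two distinct vertices of \<open>F\<close> on \<open>oe F\<close> have the midpoint \<open>moe F\<close>, so any
  other node has a parent in the interior of \<open>oe F\<close>.\<close>

lemma interior_edge_node_parents:
  assumes T: "refinement T0 T" and F: "F \<in> T" and x: "x \<in> nodes T" "x \<in> oe F" "x \<notin> vertices F"
  shows "parents x \<subseteq> oe F" "x \<noteq> moe F \<Longrightarrow> \<not> parents x \<subseteq> vertices F"
proof -
  obtain m where m: "gen m F" using mesh_gen[OF T F] .
  note nd = gen_nondegenerate[OF m]
  have xF: "x \<in> body F" using x(2) oe_subset_body by blast
  have xm: "x \<notin> N m" using N_vertex[OF _ m _ xF] x(3) by blast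
  have "\<exists>n H. generated {F} (n - m) H \<and> m \<le> n \<and> gen n H \<and> x = moe H"
  proof -
    obtain k where "x \<in> N k" using nodes_N[OF T x(1)] .
    \<comment> \<open>the level on which \<open>x\<close> becomes a node\<close>
    define j where "j = (LEAST j. x \<in> N j)"
    have j: "x \<in> N j" unfolding j_def using \<open>x \<in> N k\<close> by (rule LeastI)
    have "m < j" using j xm N_mono by (meson not_le subsetD)
    then obtain n where n: "j = Suc n" "m \<le> n" by (cases j) auto
    have "x \<notin> N n" using not_less_Least[of n "\<lambda>j. x \<in> N j"] n(1) unfolding j_def by simp
    then obtain G where G: "gen n G" "x = moe G" using j by (auto simp: n(1) N_Suc)
    obtain H where H: "generated {F} (n - m) H" "x \<in> body H" using generated_cover[OF xF] .
    have gH: "gen n H" using generated_trans[OF H(1) m] n(2) by simp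
    have "base G = base H" using moe_in_same_level[OF G(1) gH] H(2) G(2) by simp
    then have "x = moe H" unfolding G(2)
      by (auto simp: base_def moe_def doubleton_eq_iff midpoint_sym)
    then show ?thesis using H(1) gH n(2) by blast
  qed
  then obtain n H where H: "generated {F} (n - m) H" "gen n H" "x = moe H" by blast
  have par: "parents x = base H" using parents_moe[OF H(2)] H(3) by simp
  have "base H \<subseteq> body F" using body_generated[OF H(1)] base_subset_body(1) by blast
  then have "base1 H \<in> oe F" "base2 H \<in> oe F"
    using midpoint_in_face[OF nd base_subset_body(2), of "base1 H" "base2 H"] x(2) H(3)
    by (auto simp: base_def moe_def oe_eq_hull)
  then show sub: "parents x \<subseteq> oe F" unfolding par by (simp add: base_def)
  show "\<not> parents x \<subseteq> vertices F" if "x \<noteq> moe F"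
  proof
    assume "parents x \<subseteq> vertices F"
    then have "base H \<subseteq> base F"
      using sub vertex_in_hull[OF nd base_subset_body(2)] unfolding par oe_eq_hull by blast
    moreover have "base1 H \<noteq> base2 H" using nondegenerate_distinct(3)[OF gen_nondegenerate[OF H(2)]] .
    ultimately have "moe H = moe F" by (auto simp: base_def moe_def midpoint_sym)
    then show False using that H(3) by simp
  qed
qed

text \<open>Bisecting \<open>F\<close> reduces the index of \<open>moe F\<close> to \<open>0\<close>. The reduction spreads to all nodes inside \<open>oe F\<close> by induction:
  each of them except \<open>moe F\<close> has an interior parent, so its index exceeds that of \<open>moe F\<close>, which in turn
  exceeds the indices of the two endpoints of \<open>oe F\<close>. Thus an unreduced endpoint never attains the maximum
  over the parents. The set \<open>P\<close> will be the base of an element \<open>E\<close> with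
  \<open>oe E\<close> properly contained in \<open>oe F\<close>; the midpoint of \<open>oe E\<close> need not be a node yet.\<close>

lemma index_drops_on_bisected_edge:
  assumes T: "refinement T0 T" and F: "F \<in> T"
  defines "g \<equiv> global_index T0 T" and "g' \<equiv> global_index T0 (bisect T F)"
  assumes P: "P \<subseteq> oe F" "P \<subseteq> nodes T" "\<not> P \<subseteq> vertices F" and k: "\<And>p. p \<in> P \<Longrightarrow> g p \<le> k"
  shows "moe F \<in> nodes T" "\<And>p. p \<in> P \<Longrightarrow> g' p < k"
proof -
  let ?Q = "\<lambda>x. moe F \<in> nodes T \<and> g (moe F) \<le> g x \<and> g' x < g x"
  obtain m where m: "gen m F" using mesh_gen[OF T F] .
  note nd = gen_nondegenerate[OF m]
  have T': "refinement T0 (bisect T F)" using T F by (rule refinement.step)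
  have hanging: "hanging_node T x" if "x \<in> nodes T" "x \<in> oe F" "x \<notin> vertices F" for x
    using that F oe_subset_body unfolding hanging_node_def proper_node_def by blast
  \<comment> \<open>one step of the induction, also used for \<open>P\<close> itself at the end\<close>
  have pair: "moe F \<in> nodes T \<and> g (moe F) \<le> k \<and> (\<forall>p\<in>P. g' p < k)"
    if P: "P \<subseteq> oe F" "P \<subseteq> nodes T" "\<not> P \<subseteq> vertices F" "\<And>p. p \<in> P \<Longrightarrow> g p \<le> k"
      and Q: "\<And>p. p \<in> P \<Longrightarrow> p \<notin> vertices F \<Longrightarrow> ?Q p" for P k
  proof -
    obtain q where q: "q \<in> P" "q \<notin> vertices F" using P(3) by blast
    have mo: "moe F \<in> nodes T" "g (moe F) \<le> k" using Q[OF q] P(4)[OF q(1)] by auto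
    have hm: "hanging_node T (moe F)" using hanging[OF mo(1) moe_in_oe moe_not_vertex[OF nd]] .
    have "g' p < k" if p: "p \<in> P" for p
    proof (cases "p \<in> vertices F")
      case True
      then have "p \<in> base F"
        using p P(1) vertex_in_hull[OF nd base_subset_body(2)] unfolding oe_eq_hull by blast
      then have "g p < g (moe F)"
        unfolding g_def using parent_index_less[OF T hm] parents_moe[OF m] by blast
      moreover have "g' p \<le> g p"
        unfolding g_def g'_def using global_index_bisect_le[OF T F] P(2) p by blast
      ultimately show ?thesis using mo(2) by simp
    next
      case False
      then show ?thesis using Q[OF p] P(4)[OF p] by fastforce
    qed
    then show ?thesis using mo by blast
  qed
  have Q: "?Q x" if "x \<in> nodes T" "x \<in> oe F" "x \<notin> vertices F" for x
    using T that
  proof (induction rule: node_induct)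
    case (node x)
    note h = hanging[OF node(1,3,4)]
    have x0: "x \<notin> N 0" using h proper_if_N0[OF T node(1)] by (auto simp: hanging_node_def)
    have pos: "g x > 0" unfolding g_def using global_index_hanging[OF T h] by (metis zero_less_Suc)
    show ?case
    proof (cases "x = moe F")
      case True
      then have "g' x = 0"
        unfolding g'_def using moe_proper_after_bisect[OF T F] node(1) global_index_proper by simp
      then show ?thesis using True node(1) pos by simp
    next
      case False
      note par = interior_edge_node_parents[OF T F node(1,3,4)]
      have "moe F \<in> nodes T \<and> g (moe F) \<le> g x - 1 \<and> (\<forall>p\<in>parents x. g' p < g x - 1)"
      proof (rule pair[OF par(1) _ par(2)[OF False]])
        show "parents x \<subseteq> nodes T" using parents_subset_nodes[OF T node(1) x0] .
        show "g p \<le> g x - 1" if "p \<in> parents x" for p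
          using parent_index_less[OF T h that] unfolding g_def by simp
        show "?Q p" if "p \<in> parents x" "p \<notin> vertices F" for p
          using node(2)[OF x0 that(1)] that par(1) by blast
      qed
      moreover from this have "g' x \<le> Suc (g x - 2)"
        unfolding g'_def
        by (intro index_le_Suc_parents[OF T']) (use node(1) F in \<open>auto simp: nodes_bisect\<close>)
      moreover have "parents x \<noteq> {}" using par(2)[OF False] by blast
      ultimately show ?thesis by fastforce
    qed
  qed
  have "moe F \<in> nodes T \<and> g (moe F) \<le> k \<and> (\<forall>p\<in>P. g' p < k)"
    using P k Q by (intro pair) blast+
  then show "moe F \<in> nodes T" "\<And>p. p \<in> P \<Longrightarrow> g' p < k" by auto
qed

text \<open>After bisecting only \<open>F\<close>, the mesh need not be admissible: if \<open>oe E = oe F\<close>, the new node may have index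
  \<open>\<Lambda> + 1\<close> until \<open>E\<close> is bisected as well.\<close>

lemma admissible_bisect_compatible_pair:
  assumes adm: "admissible T0 \<Lambda> T" and EF: "E \<in> T" "F \<in> T" "F \<noteq> E" and sub: "oe E \<subseteq> oe F"
  shows "admissible T0 \<Lambda> (bisect (bisect T F) E)"
proof -
  have T: "refinement T0 T" using adm by (rule admissibleD)
  let ?T1 = "bisect T F"
  let ?T2 = "bisect ?T1 E"
  have T1: "refinement T0 ?T1" using T EF(2) by (rule refinement.step)
  have E1: "E \<in> ?T1" using EF by (auto simp: bisect_def)
  have T2: "refinement T0 ?T2" using T1 E1 by (rule refinement.step)
  obtain n where n: "gen n E" using mesh_gen[OF T EF(1)] .
  obtain m where m: "gen m F" using mesh_gen[OF T EF(2)] .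
  have old: "global_index T0 ?T2 x \<le> \<Lambda>" if "x \<in> nodes T" for x
  proof -
    have "global_index T0 ?T2 x \<le> global_index T0 ?T1 x"
      using global_index_bisect_le[OF T1 E1] that EF(2) by (simp add: nodes_bisect)
    then show ?thesis using global_index_bisect_le[OF T EF(2) that] admissibleD(2)[OF adm that] by simp
  qed
  have new: "global_index T0 ?T2 (moe E) \<le> \<Lambda> \<and> moe F \<in> insert (moe E) (nodes T)"
  proof (cases "base E = base F")
    case True
    then have eq: "moe E = moe F" by (auto simp: base_def moe_def doubleton_eq_iff midpoint_sym)
    then have "moe E \<in> nodes ?T1" using EF(2) by (simp add: nodes_bisect)
    then have "proper_node ?T2 (moe E)" by (rule moe_proper_after_bisect[OF T1 E1])
    then show ?thesis using eq by (simp add: global_index_proper)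
  next
    case False
    have bsub: "base E \<subseteq> oe F" using sub hull_subset[of "base E" convex] by (simp add: oe_eq_hull[of E])
    have "\<not> base E \<subseteq> vertices F"
    proof
      assume "base E \<subseteq> vertices F"
      then have "base E \<subseteq> base F"
        using bsub vertex_in_hull[OF gen_nondegenerate[OF m] base_subset_body(2)]
        unfolding oe_eq_hull by blast
      then show False using False nondegenerate_distinct(3)[OF gen_nondegenerate[OF n]]
        by (auto simp: base_def)
    qed
    note drop = index_drops_on_bisected_edge[OF T EF(2) bsub base_nodes[OF EF(1)] this, of \<Lambda>]
    have idx: "global_index T0 T p \<le> \<Lambda>" if "p \<in> base E" for p
      using admissibleD(2)[OF adm] base_nodes[OF EF(1)] that by blast
    have "global_index T0 ?T2 (moe E) \<le> Suc (\<Lambda> - 1)"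
    proof (rule index_le_Suc_parents[OF T2])
      show "moe E \<in> nodes ?T2" using E1 by (simp add: nodes_bisect)
      fix p assume "p \<in> parents (moe E)"
      then have p: "p \<in> base E" by (simp add: parents_moe[OF n])
      then have "p \<in> nodes ?T1" using base_nodes[OF E1] by blast
      then show "global_index T0 ?T2 p \<le> \<Lambda> - 1"
        using global_index_bisect_le[OF T1 E1] drop(2)[OF idx p] by fastforce
    qed
    moreover have "\<Lambda> > 0" using drop(2)[OF idx, of "base1 E"] by (auto simp: base_def)
    ultimately show ?thesis using drop(1)[OF idx] by simp
  qed
  have "nodes ?T2 = insert (moe E) (insert (moe F) (nodes T))"
    using E1 EF(2) by (simp add: nodes_bisect)
  then show ?thesis using T2 old new by (auto simp: admissible_def)
qed

section \<open>The chain and its loop\<close>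

text \<open>Bisections act on the progeny of each element separately, so the elements of the chain can be treated
  one at a time.\<close>

lemma progeny_bisect_self:
  assumes "A \<in> T'" "generated {F} k A"
  shows "progeny (bisect T' A) F = bisect (progeny T' F) A"
  using assms unfolding progeny_def bisect_def by (auto intro: generated.child)

lemma progeny_bisect_other:
  assumes T: "refinement T0 T" and F: "F \<in> T" "F0 \<in> T" "F \<noteq> F0" and A: "generated {F0} k A"
  shows "progeny (bisect T' A) F = progeny T' F"
proof -
  have "\<not> generated {F} i G" if G: "G \<in> insert A (children A)" for i G
  proof -
    obtain j where "generated {F0} j G" using A G generated.child by blast
    then show ?thesis using mesh_disjoint[OF T F(1,2)] F(3) by blast
  qed
  then show ?thesis unfolding progeny_def bisect_def by blast
qed

lemma progeny_member:
  assumes "refinement T0 T'" "F \<in> T'"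
  shows "progeny T' F = {F}"
  using mesh_antichain[OF assms] generated.init[of F "{F}"] assms(2) unfolding progeny_def by blast

lemma bisect_singleton: "bisect {F} F = children F"
  by (simp add: bisect_def)

text \<open>The complete effect of the chain of an element \<open>E\<close> of level \<open>n\<close>, up to but not including the
  final bisection of \<open>E\<close>. Admissibility is only demanded after that bisection, since the mesh \<open>T'\<close>
  itself may contain one node of index \<open>\<Lambda> + 1\<close>. The head of \<open>es\<close> is \<open>E\<close>, still
  to be bisected, which is why some clauses refer to \<open>tl es\<close>.\<close>

definition chain_outcome :: "nat \<Rightarrow> mesh \<Rightarrow> triangle \<Rightarrow> nat \<Rightarrow> triangle list \<Rightarrow> mesh \<Rightarrow> bool" where
  "chain_outcome \<Lambda> T E n es T' \<longleftrightarrow>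
     (\<forall>es'. adm_chain T0 \<Lambda> T E es' \<longleftrightarrow> es' = es) \<and>
     (\<forall>T1. chain_loop T es T1 \<longleftrightarrow> T1 = T') \<and>
     (\<exists>r. es = E # r) \<and> set es \<subseteq> T \<and> distinct es \<and> length es \<le> n + 1 \<and>
     (\<forall>F\<in>set es. level T0 F \<le> n) \<and>
     refinement T0 T' \<and> T - set (tl es) \<subseteq> T' \<and>
     (\<forall>F\<in>set (tl es). bisected_once T' F \<or> bisected_twice T' F) \<and>
     (\<forall>G\<in>T' - T. level T0 G \<le> n + 1) \<and>
     admissible T0 \<Lambda> (bisect T' E)"

lemma chain_loop_single: "chain_loop T [E] T1 \<longleftrightarrow> T1 = T"
  by (auto intro: chain_loop.single elim: chain_loop.cases)

lemma compatible_sym: "compatible E F \<longleftrightarrow> compatible F E"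
  by (auto simp: compatible_def adjacent_def Int_commute)

lemma chain_outcome_stop:
  assumes adm: "admissible T0 \<Lambda> T" and E: "E \<in> T" "gen n E" and index: "moe_index T0 T E \<le> \<Lambda>"
  shows "chain_outcome \<Lambda> T E n [E] T"
proof -
  have "adm_chain T0 \<Lambda> T E es' \<longleftrightarrow> es' = [E]" for es'
    using index by (auto intro: adm_chain.stop elim: adm_chain.cases)
  then show ?thesis
    using admissible_bisect[OF adm E(1) index] admissibleD(1)[OF adm] E level_eq
    by (simp add: chain_outcome_def chain_loop_single)
qed

text \<open>A compatible facing element ends the chain without any condition on its own index. Its level may
  equal that of \<open>E\<close>, so the bound on the length needs \<open>n \<noteq> 0\<close>.\<close>

lemma chain_outcome_compatible:
  assumes adm: "admissible T0 \<Lambda> T" and E: "E \<in> T" "gen n E" and "\<Lambda> \<ge> 1"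
    and index: "moe_index T0 T E = \<Lambda> + 1" and f: "facing T E F" and c: "compatible E F"
  shows "chain_outcome \<Lambda> T E n [E, F] (bisect T F)"
proof -
  have T: "refinement T0 T" using adm by (rule admissibleD)
  have F: "F \<in> T" "F \<noteq> E" "oe E \<subseteq> body F" using f by (auto simp: facing_def)
  obtain m where m: "gen m F" using mesh_gen[OF T F(1)] .
  have mn: "m \<le> n" using facing_level(1)[OF T E(1) f E(2) m] .
  have "n \<noteq> 0"
  proof
    assume "n = 0"
    then have "moe_index T0 T E \<le> \<Lambda>" using moe_index_level_0[OF adm E(1) _ \<open>\<Lambda> \<ge> 1\<close>] E(2) by simp
    then show False using index by simp
  qed
  have uniq: "G = F" if "facing T E G" for G
    using facing_unique[OF T E(1) _ _ _ F] that by (auto simp: facing_def)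
  have chain: "adm_chain T0 \<Lambda> T E es' \<longleftrightarrow> es' = [E, F]" for es'
  proof
    assume "adm_chain T0 \<Lambda> T E es'"
    then show "es' = [E, F]" using index uniq c by cases auto
  qed (use adm_chain.compat[OF index f c] in simp)
  have loop: "chain_loop T [E, F] T1 \<longleftrightarrow> T1 = bisect T F" for T1
  proof
    assume "chain_loop T [E, F] T1"
    then show "T1 = bisect T F" using c compatible_sym chain_loop_single by cases auto
  next
    assume "T1 = bisect T F"
    then show "chain_loop T [E, F] T1"
      using chain_loop.once[of T F "[]" T E] chain_loop.single c compatible_sym F(1) by simp
  qed
  have "progeny (bisect T F) F = children F"
    using progeny_bisect_self[OF F(1) generated.init[of F "{F}"]] progeny_member[OF T F(1)]
    by (simp add: bisect_singleton)
  then have once: "bisected_once (bisect T F) F" by (simp add: bisected_once_def)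
  have lev: "level T0 G \<le> n + 1" if "G \<in> bisect T F - T" for G
  proof -
    have "gen (Suc m) G" using that m by (auto simp: bisect_def intro: generated.child)
    then show ?thesis using level_eq mn by simp
  qed
  show ?thesis
    unfolding chain_outcome_def
    using chain loop once lev E F mn \<open>n \<noteq> 0\<close> level_eq[OF E(2)] level_eq[OF m] refinement.step[OF T F(1)]
      admissible_bisect_compatible_pair[OF adm E(1) F(1,2) facing_compatible[OF T E(1) f c]]
    by (auto simp: bisect_def)
qed

text \<open>By the assumption on \<open>F\<close>, the mesh is admissible once \<open>F\<close> is bisected. The child \<open>C\<close> of \<open>F\<close>
  facing \<open>E\<close> is compatible with \<open>E\<close>, so \<open>C\<close> and \<open>E\<close> can be bisected next. Since \<open>F\<close> has a smaller level than
  \<open>E\<close>, even the children of \<open>C\<close> have at most the level of the children of \<open>E\<close>.\<close>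

lemma chain_outcome_continue:
  assumes adm: "admissible T0 \<Lambda> T" and E: "E \<in> T" "gen n E"
    and index: "moe_index T0 T E = \<Lambda> + 1" and f: "facing T E F" and c: "\<not> compatible E F"
    and m: "gen m F" and run: "chain_outcome \<Lambda> T F m es T1"
  shows "\<exists>T'. chain_outcome \<Lambda> T E n (E # es) T'"
proof -
  have T: "refinement T0 T" using adm by (rule admissibleD)
  have F: "F \<in> T" "F \<noteq> E" "oe E \<subseteq> body F" using f by (auto simp: facing_def)
  have mn: "m < n" using facing_level(2)[OF T E(1) f E(2) m c] .
  obtain r where es: "es = F # r" using run by (auto simp: chain_outcome_def)
  have run_chain: "\<And>es'. adm_chain T0 \<Lambda> T F es' \<longleftrightarrow> es' = es"
    and run_loop: "\<And>T2. chain_loop T es T2 \<longleftrightarrow> T2 = T1"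
    and r: "set r \<subseteq> T" "F \<notin> set r" "distinct r" "length r \<le> m" "\<And>G. G \<in> set r \<Longrightarrow> level T0 G \<le> m"
    and T1: "refinement T0 T1" "T - set r \<subseteq> T1"
    and T1r: "\<And>G. G \<in> set r \<Longrightarrow> bisected_once T1 G \<or> bisected_twice T1 G"
    and T1lev: "\<And>G. G \<in> T1 - T \<Longrightarrow> level T0 G \<le> m + 1"
    and adm2: "admissible T0 \<Lambda> (bisect T1 F)"
    using run unfolding chain_outcome_def es by auto
  have FT1: "F \<in> T1" using T1(2) F(1) r(2) by blast
  let ?T2 = "bisect T1 F"
  have T2: "refinement T0 ?T2" using T1(1) FT1 by (rule refinement.step)
  have Er: "E \<notin> set r" using r(5) level_eq[OF E(2)] mn by fastforce
  have ET2: "E \<in> ?T2" using T1(2) E(1) Er F(2) by (auto simp: bisect_def)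
  obtain C where C: "C \<in> children F" "oe E \<subseteq> oe C" using facing_incompatible[OF T E(1) f c] .
  have FC: "generated {F} (Suc 0) C" using C(1) by (auto intro: generated.intros)
  have gC: "gen (Suc m) C" using m C(1) by (rule generated.child)
  have CT: "C \<notin> T" using mesh_antichain[OF T F(1) _ FC] gen_level_unique[OF m] gC by fastforce
  have CT2: "C \<in> ?T2" "C \<noteq> E" using C(1) CT E(1) by (auto simp: bisect_def)
  have fC: "facing ?T2 E C"
    using facingI[OF T2 ET2 CT2] C(2) oe_subset_body by blast
  let ?T3 = "bisect ?T2 C"
  have T3: "refinement T0 ?T3" using T2 CT2(1) by (rule refinement.step)
  have uniq: "G = F" if "facing T E G" for G
    using facing_unique[OF T E(1) _ _ _ F] that by (auto simp: facing_def)
  have uniqC: "D = C" if "facing ?T2 E D" for D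
    using facing_unique[OF T2 ET2 _ _ _ CT2] facing_oe_subset[OF fC] that by (auto simp: facing_def)
  have chain: "adm_chain T0 \<Lambda> T E es' \<longleftrightarrow> es' = E # es" for es'
  proof
    assume "adm_chain T0 \<Lambda> T E es'"
    then show "es' = E # es" using index uniq c run_chain by cases auto
  qed (use adm_chain.continue[OF index f c] run_chain in simp)
  have loop: "chain_loop T (E # es) T' \<longleftrightarrow> T' = ?T3" for T'
  proof
    assume "chain_loop T (E # es) T'"
    then show "T' = ?T3" unfolding es
      using c compatible_sym run_loop[unfolded es] uniqC by cases auto
  next
    assume "T' = ?T3"
    then show "chain_loop T (E # es) T'"
      using chain_loop.twice[OF run_loop[THEN iffD2, OF HOL.refl, unfolded es] _ FT1 C(1) fC]
        c compatible_sym unfolding es by blast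
  qed
  have "progeny ?T2 F = children F"
    using progeny_bisect_self[OF FT1 generated.init[of F "{F}"]] progeny_member[OF T1(1) FT1]
    by (simp add: bisect_singleton)
  then have "progeny ?T3 F = bisect (children F) C"
    using progeny_bisect_self[OF CT2(1) FC] by simp
  then have twice: "bisected_twice ?T3 F" using C(1) by (auto simp: bisected_twice_def)
  have others: "bisected_once ?T3 G \<or> bisected_twice ?T3 G" if "G \<in> set r" for G
  proof -
    have G: "G \<in> T" "G \<noteq> F" using that r by auto
    have "progeny ?T3 G = progeny T1 G"
      using progeny_bisect_other[OF T G(1) F(1) G(2) FC, of ?T2]
        progeny_bisect_other[OF T G(1) F(1) G(2) generated.init[of F "{F}"], of T1] by simp
    then show ?thesis using T1r[OF that] by (simp add: bisected_once_def bisected_twice_def)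
  qed
  have lev: "level T0 G \<le> n + 1" if G: "G \<in> ?T3 - T" for G
  proof -
    consider "G \<in> children C" | "G \<in> children F" | "G \<in> T1 - T" using G by (auto simp: bisect_def)
    then show ?thesis
    proof cases
      case 1
      then show ?thesis using level_eq[OF generated.child[OF gC 1]] mn by simp
    next
      case 2
      then show ?thesis using level_eq[OF generated.child[OF m 2]] mn by simp
    next
      case 3
      then show ?thesis using T1lev[OF 3] mn by simp
    qed
  qed
  have keep: "T - set es \<subseteq> ?T3" using T1(2) CT unfolding es by (auto simp: bisect_def)
  have "chain_outcome \<Lambda> T E n (E # es) ?T3"
    unfolding chain_outcome_def
  proof (intro conjI allI ballI)
    show "set (E # es) \<subseteq> T" using E(1) F(1) r(1) by (simp add: es)
    show "distinct (E # es)" using Er F(2) r by (simp add: es)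
    show "length (E # es) \<le> n + 1" using r(4) mn by (simp add: es)
    show "T - set (tl (E # es)) \<subseteq> ?T3" using keep by simp
    show "admissible T0 \<Lambda> (bisect ?T3 E)"
      by (rule admissible_bisect_compatible_pair[OF adm2 ET2 CT2 C(2)])
    show "level T0 G \<le> n" if "G \<in> set (E # es)" for G
      using that r(5)[of G] level_eq[OF E(2)] level_eq[OF m] mn by (auto simp: es)
    show "bisected_once ?T3 G \<or> bisected_twice ?T3 G" if "G \<in> set (tl (E # es))" for G
      using that twice others by (auto simp: es)
  qed (use chain loop T3 lev in auto)
  then show ?thesis ..
qed

lemma chain_outcome_ex:
  assumes adm: "admissible T0 \<Lambda> T" and "\<Lambda> \<ge> 1" and "E \<in> T" "gen n E"
  shows "\<exists>es T'. chain_outcome \<Lambda> T E n es T'"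
  using assms(3,4)
proof (induction n arbitrary: E rule: less_induct)
  case (less n)
  have T: "refinement T0 T" using adm by (rule admissibleD)
  show ?case
  proof (cases "moe_index T0 T E \<le> \<Lambda>")
    case True
    then show ?thesis using chain_outcome_stop[OF adm less.prems] by blast
  next
    case False
    then have index: "moe_index T0 T E = \<Lambda> + 1"
      using moe_index_le_Suc[OF adm less.prems(1)] by simp
    then obtain F where f: "facing T E F" using facing_ex[OF adm less.prems(1)] by blast
    show ?thesis
    proof (cases "compatible E F")
      case True
      then show ?thesis using chain_outcome_compatible[OF adm less.prems \<open>\<Lambda> \<ge> 1\<close> index f] by blast
    next
      case False
      have F: "F \<in> T" using f by (simp add: facing_def)
      obtain m where m: "gen m F" using mesh_gen[OF T F] .
      have "m < n" using facing_level(2)[OF T less.prems(1) f less.prems(2) m False] .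
      then obtain es T1 where "chain_outcome \<Lambda> T F m es T1" using less.IH F m by blast
      then show ?thesis using chain_outcome_continue[OF adm less.prems index f False m] by blast
    qed
  qed
qed

end

theorem proposition11p7:
  fixes \<Omega> :: "point set" and T0 T :: mesh and E :: triangle and \<Lambda> :: nat
  assumes "initial_mesh \<Omega> T0"
    and "\<Lambda> \<ge> 1"
    and "admissible T0 \<Lambda> T"
    and "E \<in> T"
  shows "\<exists>es Tstar.
    (\<forall>es'. adm_chain T0 \<Lambda> T E es' \<longleftrightarrow> es' = es) \<and>
    (\<forall>T'. create_admissible_chain T0 T E \<Lambda> T' \<longleftrightarrow> T' = Tstar) \<and>
    set es \<subseteq> T \<and>
    (\<forall>F \<in> set es. bisected_once Tstar F \<or> bisected_twice Tstar F) \<and>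
    T - set es \<subseteq> Tstar \<and>
    distinct es \<and> card (set es) \<le> level T0 E + 1 \<and>
    admissible T0 \<Lambda> Tstar \<and>
    bisected_once Tstar E \<and>
    (\<forall>E' \<in> Tstar - T. level T0 E' \<le> level T0 E + 1)"
proof -
  interpret matched_initial_mesh T0
    using initial_mesh_conforming initial_mesh_matching assms(1) by unfold_locales
  have T: "refinement T0 T" using assms(3) by (rule admissibleD)
  obtain n where n: "gen n E" using mesh_gen[OF T assms(4)] .
  obtain es T' where run: "chain_outcome \<Lambda> T E n es T'"
    using chain_outcome_ex[OF assms(3,2,4) n] by blast
  obtain r where es: "es = E # r" using run by (auto simp: chain_outcome_def)
  have chain: "\<And>es'. adm_chain T0 \<Lambda> T E es' \<longleftrightarrow> es' = es"
    and loop: "\<And>T1. chain_loop T es T1 \<longleftrightarrow> T1 = T'"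
    and r: "set es \<subseteq> T" "E \<notin> set r" "distinct es" "length es \<le> n + 1"
    and T': "refinement T0 T'" "T - set r \<subseteq> T'"
    and T'r: "\<And>G. G \<in> set r \<Longrightarrow> bisected_once T' G \<or> bisected_twice T' G"
    and T'lev: "\<And>G. G \<in> T' - T \<Longrightarrow> level T0 G \<le> n + 1"
    and adm: "admissible T0 \<Lambda> (bisect T' E)"
    using run unfolding chain_outcome_def es by auto
  have ET': "E \<in> T'" using T'(2) assms(4) r(2) by blast
  have call: "create_admissible_chain T0 T E \<Lambda> T1 \<longleftrightarrow> T1 = bisect T' E" for T1
    using chain loop ET' by (auto simp: create_admissible_chain_def)
  have "progeny (bisect T' E) E = children E"
    using progeny_bisect_self[OF ET' generated.init[of E "{E}"]] progeny_member[OF T'(1) ET']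
    by (simp add: bisect_singleton)
  then have once: "bisected_once (bisect T' E) E" by (simp add: bisected_once_def)
  have others: "bisected_once (bisect T' E) G \<or> bisected_twice (bisect T' E) G" if "G \<in> set r" for G
  proof -
    have G: "G \<in> T" "G \<noteq> E" using that r by (auto simp: es)
    have "progeny (bisect T' E) G = progeny T' G"
      using progeny_bisect_other[OF T G(1) assms(4) G(2) generated.init[of E "{E}"]] by simp
    then show ?thesis using T'r[OF that] by (simp add: bisected_once_def bisected_twice_def)
  qed
  have lev: "level T0 G \<le> n + 1" if G: "G \<in> bisect T' E - T" for G
  proof -
    consider "G \<in> children E" | "G \<in> T' - T" using G by (auto simp: bisect_def)
    then show ?thesis
    proof cases
      case 1
      then show ?thesis using level_eq[OF generated.child[OF n 1]] by simp
    qed (rule T'lev)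
  qed
  show ?thesis
  proof (intro exI[of _ es] exI[of _ "bisect T' E"] conjI allI ballI)
    show "T - set es \<subseteq> bisect T' E" using T'(2) by (auto simp: es bisect_def)
    show "card (set es) \<le> level T0 E + 1"
      using r(3,4) level_eq[OF n] by (simp add: distinct_card)
    show "bisected_once (bisect T' E) G \<or> bisected_twice (bisect T' E) G" if "G \<in> set es" for G
      using that once others by (auto simp: es)
  qed (use chain call r adm once lev level_eq[OF n] in auto)
qed

end
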